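(* Let $(X_n)_{n\in\mathbb{N}}$ be a sequence of expander graphs, let $X=\bigsqcup_nX_n$ be their coarse disjoint union, and let $w\colon\mathbb{N}\to\mathbb{R}$ be a map. For each $n$ let $p_n$ be the averaging projection on $\ell_2(X_n)\subseteq\ell_2(X)$ (the orthogonal projection onto the constant vectors in $\ell_2(X_n)$), let $h_n=w(n)p_n$ and $h=\mathrm{SOT}\text{-}\sum_nh_n$ (a self-adjoint operator on $\ell_2(X)$). Then: (1) $\sigma_h$, given by $\sigma_{h,t}(a)=e^{ith}ae^{-ith}$, is a pre-flow on $\mathrm{C}^*_u(X)$; (2) if $w$ is unbounded, $\sigma_h$ is not a flow; (3) if $w$ is unbounded, the pre-flow $\sigma_h$ is not a cocycle perturbation of any diagonal pre-flow on $\mathrm{C}^*_u(X)$, i.e. of any pre-flow $\sigma_k$ with $k\colon X\to\mathbb{R}$ a map viewed as a multiplication operator.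
   Context: A sequence of expander graphs is a sequence $(X_n)$ of finite connected graphs with uniformly bounded vertex degrees, $|X_n|\to\infty$, and a uniform lower bound $c>0$ on their Cheeger constants: $|\partial A|\ge c|A|$ for all $A\subseteq X_n$ with $|A|\le|X_n|/2$, where $\partial A$ is the set of edges between $A$ and its complement. Each $X_n$ carries its shortest-path metric; the coarse disjoint union $X=\bigsqcup_nX_n$ is the disjoint union with a metric restricting to the graph metric on each $X_n$ and with $d(X_n,X_m)\to\infty$ as $n+m\to\infty$ ($n\ne m$); it is uniformly locally finite. A partial translation is a bijection $f\colon\mathrm{dom}(f)\subseteq X\to\mathrm{ran}(f)\subseteq X$ with $\sup_{x}d(x,f(x))<\infty$; $v_f\delta_x=\delta_{f(x)}$ on $\mathrm{dom}(f)$, $0$ elsewhere; $\mathrm{C}^*_u(X)$ is the $\mathrm{C}^*$-algebra generated by the $v_f$. A pre-flow on a unital $\mathrm{C}^*$-algebra $A$ is a group homomorphism $\sigma\colon\mathbb{R}\to\mathrm{Aut}(A)$, and a flow is a pre-flow with $t\mapsto\sigma_t(a)$ norm continuous for every $a$. A cocycle for $\sigma$ is a norm continuous family of unitaries $(u_t)$ in $A$ with $u_{t+s}=u_t\sigma_t(u_s)$, and $\rho_t=u_t\sigma_t(\cdot)u_t^*$ is then a cocycle perturbation of $\sigma$. *)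

theory Defs
  imports "HOL-Analysis.Analysis"
begin

definition walk :: "'a set \<Rightarrow> ('a \<Rightarrow> 'a \<Rightarrow> bool) \<Rightarrow> 'a list \<Rightarrow> bool" where
  "walk V E xs \<longleftrightarrow> xs \<noteq> [] \<and> set xs \<subseteq> V \<and> (\<forall>i. Suc i < length xs \<longrightarrow> E (xs ! i) (xs ! Suc i))"

definition gdist :: "'a set \<Rightarrow> ('a \<Rightarrow> 'a \<Rightarrow> bool) \<Rightarrow> 'a \<Rightarrow> 'a \<Rightarrow> nat" where
  "gdist V E x y = (LEAST k. \<exists>xs. walk V E xs \<and> hd xs = x \<and> last xs = y \<and> length xs = Suc k)"

definition graph_connected :: "'a set \<Rightarrow> ('a \<Rightarrow> 'a \<Rightarrow> bool) \<Rightarrow> bool" where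
  "graph_connected V E \<longleftrightarrow> V \<noteq> {} \<and>
     (\<forall>x\<in>V. \<forall>y\<in>V. \<exists>xs. walk V E xs \<and> hd xs = x \<and> last xs = y)"

definition simple_graph :: "'a set \<Rightarrow> ('a \<Rightarrow> 'a \<Rightarrow> bool) \<Rightarrow> bool" where
  "simple_graph V E \<longleftrightarrow> (\<forall>x y. E x y \<longrightarrow> x \<in> V \<and> y \<in> V \<and> x \<noteq> y \<and> E y x)"

text \<open>Edge boundary of A inside V: each edge between A and V - A is counted once
  (as the ordered pair with first component in A).\<close>
definition edge_boundary :: "'a set \<Rightarrow> ('a \<Rightarrow> 'a \<Rightarrow> bool) \<Rightarrow> 'a set \<Rightarrow> ('a \<times> 'a) set" where
  "edge_boundary V E A = {(x, y). x \<in> A \<and> y \<in> V - A \<and> E x y}"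

definition expander_seq :: "(nat \<Rightarrow> 'a set) \<Rightarrow> (nat \<Rightarrow> 'a \<Rightarrow> 'a \<Rightarrow> bool) \<Rightarrow> bool" where
  "expander_seq V E \<longleftrightarrow>
     (\<forall>n. finite (V n) \<and> simple_graph (V n) (E n) \<and> graph_connected (V n) (E n)) \<and>
     (\<exists>D::nat. \<forall>n. \<forall>x\<in>V n. card {y \<in> V n. E n x y} \<le> D) \<and>
     filterlim (\<lambda>n. card (V n)) at_top sequentially \<and>
     (\<exists>c::real. c > 0 \<and> (\<forall>n. \<forall>A. A \<subseteq> V n \<and> real (card A) \<le> real (card (V n)) / 2 \<longrightarrow>
          real (card (edge_boundary (V n) (E n) A)) \<ge> c * real (card A)))"

definition Xc :: "(nat \<Rightarrow> 'a set) \<Rightarrow> (nat \<times> 'a) set" where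
  "Xc V = (SIGMA n:UNIV. V n)"

definition coarse_union_metric ::
  "(nat \<Rightarrow> 'a set) \<Rightarrow> (nat \<Rightarrow> 'a \<Rightarrow> 'a \<Rightarrow> bool) \<Rightarrow> (nat \<times> 'a \<Rightarrow> nat \<times> 'a \<Rightarrow> real) \<Rightarrow> bool" where
  "coarse_union_metric V E d \<longleftrightarrow>
     (\<forall>z\<in>Xc V. \<forall>z'\<in>Xc V. d z z' = d z' z \<and> (d z z' = 0 \<longleftrightarrow> z = z') \<and> d z z' \<ge> 0) \<and>
     (\<forall>z1\<in>Xc V. \<forall>z2\<in>Xc V. \<forall>z3\<in>Xc V. d z1 z3 \<le> d z1 z2 + d z2 z3) \<and>
     (\<forall>n. \<forall>x\<in>V n. \<forall>y\<in>V n. d (n, x) (n, y) = real (gdist (V n) (E n) x y)) \<and>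
     (\<forall>R. \<exists>N. \<forall>n m. n \<noteq> m \<longrightarrow> n + m \<ge> N \<longrightarrow>
        (\<forall>x\<in>V n. \<forall>y\<in>V m. d (n, x) (m, y) > R))"

type_synonym 'a vec = "nat \<times> 'a \<Rightarrow> complex"
type_synonym 'a op = "'a vec \<Rightarrow> 'a vec"

definition l2 :: "(nat \<Rightarrow> 'a set) \<Rightarrow> 'a vec set" where
  "l2 V = {\<xi>. (\<forall>z. z \<notin> Xc V \<longrightarrow> \<xi> z = 0) \<and> (\<lambda>z. (cmod (\<xi> z))\<^sup>2) summable_on Xc V}"

definition l2norm :: "(nat \<Rightarrow> 'a set) \<Rightarrow> 'a vec \<Rightarrow> real" where
  "l2norm V \<xi> = sqrt (infsum (\<lambda>z. (cmod (\<xi> z))\<^sup>2) (Xc V))"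

definition l2inner :: "(nat \<Rightarrow> 'a set) \<Rightarrow> 'a vec \<Rightarrow> 'a vec \<Rightarrow> complex" where
  "l2inner V \<xi> \<eta> = infsum (\<lambda>z. cnj (\<xi> z) * \<eta> z) (Xc V)"

text \<open>Bounded operators on l2(X), represented canonically as maps on all functions
  that vanish outside l2(X).\<close>
definition bop :: "(nat \<Rightarrow> 'a set) \<Rightarrow> 'a op \<Rightarrow> bool" where
  "bop V T \<longleftrightarrow> (\<forall>\<xi>. \<xi> \<notin> l2 V \<longrightarrow> T \<xi> = (\<lambda>_. 0)) \<and> (\<forall>\<xi>\<in>l2 V. T \<xi> \<in> l2 V) \<and>
     (\<forall>\<xi>\<in>l2 V. \<forall>\<eta>\<in>l2 V. \<forall>c. T (\<lambda>z. c * \<xi> z + \<eta> z) = (\<lambda>z. c * T \<xi> z + T \<eta> z)) \<and>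
     (\<exists>C. \<forall>\<xi>\<in>l2 V. l2norm V (T \<xi>) \<le> C * l2norm V \<xi>)"

definition opnorm :: "(nat \<Rightarrow> 'a set) \<Rightarrow> 'a op \<Rightarrow> real" where
  "opnorm V T = Sup {l2norm V (T \<xi>) | \<xi>. \<xi> \<in> l2 V \<and> l2norm V \<xi> \<le> 1}"

definition oid :: "(nat \<Rightarrow> 'a set) \<Rightarrow> 'a op" where
  "oid V = (\<lambda>\<xi>. if \<xi> \<in> l2 V then \<xi> else (\<lambda>_. 0))"

definition oadd :: "'a op \<Rightarrow> 'a op \<Rightarrow> 'a op" where
  "oadd T S = (\<lambda>\<xi> z. T \<xi> z + S \<xi> z)"

definition odiff :: "'a op \<Rightarrow> 'a op \<Rightarrow> 'a op" where
  "odiff T S = (\<lambda>\<xi> z. T \<xi> z - S \<xi> z)"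

definition oscale :: "complex \<Rightarrow> 'a op \<Rightarrow> 'a op" where
  "oscale c T = (\<lambda>\<xi> z. c * T \<xi> z)"

definition adj :: "(nat \<Rightarrow> 'a set) \<Rightarrow> 'a op \<Rightarrow> 'a op" where
  "adj V T = (THE S. bop V S \<and> (\<forall>\<xi>\<in>l2 V. \<forall>\<eta>\<in>l2 V. l2inner V (S \<xi>) \<eta> = l2inner V \<xi> (T \<eta>)))"

definition partial_translation ::
  "(nat \<Rightarrow> 'a set) \<Rightarrow> (nat \<times> 'a \<Rightarrow> nat \<times> 'a \<Rightarrow> real) \<Rightarrow> (nat \<times> 'a) set \<Rightarrow> (nat \<times> 'a \<Rightarrow> nat \<times> 'a) \<Rightarrow> bool" where
  "partial_translation V d D f \<longleftrightarrow> D \<subseteq> Xc V \<and> f ` D \<subseteq> Xc V \<and> inj_on f D \<and>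
     (\<exists>R. \<forall>x\<in>D. d x (f x) \<le> R)"

text \<open>v_f delta_x = delta_(f x) for x in dom f, 0 otherwise.\<close>
definition vop :: "(nat \<Rightarrow> 'a set) \<Rightarrow> (nat \<times> 'a) set \<Rightarrow> (nat \<times> 'a \<Rightarrow> nat \<times> 'a) \<Rightarrow> 'a op" where
  "vop V D f = (\<lambda>\<xi> y. if \<xi> \<in> l2 V \<and> y \<in> f ` D then \<xi> (inv_into D f y) else 0)"

definition cstar_subalg :: "(nat \<Rightarrow> 'a set) \<Rightarrow> 'a op set \<Rightarrow> bool" where
  "cstar_subalg V A \<longleftrightarrow> A \<subseteq> {T. bop V T} \<and>
     (\<forall>a\<in>A. \<forall>b\<in>A. oadd a b \<in> A \<and> a \<circ> b \<in> A) \<and>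
     (\<forall>a\<in>A. \<forall>c. oscale c a \<in> A) \<and>
     (\<forall>a\<in>A. adj V a \<in> A) \<and>
     (\<forall>T. bop V T \<and> (\<forall>e>0. \<exists>a\<in>A. opnorm V (odiff T a) < e) \<longrightarrow> T \<in> A)"

definition Cu :: "(nat \<Rightarrow> 'a set) \<Rightarrow> (nat \<times> 'a \<Rightarrow> nat \<times> 'a \<Rightarrow> real) \<Rightarrow> 'a op set" where
  "Cu V d = \<Inter>{A. cstar_subalg V A \<and> (\<forall>D f. partial_translation V d D f \<longrightarrow> vop V D f \<in> A)}"

definition star_aut :: "(nat \<Rightarrow> 'a set) \<Rightarrow> 'a op set \<Rightarrow> ('a op \<Rightarrow> 'a op) \<Rightarrow> bool" where
  "star_aut V A \<alpha> \<longleftrightarrow> bij_betw \<alpha> A A \<and>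
     (\<forall>a\<in>A. \<forall>b\<in>A. \<alpha> (oadd a b) = oadd (\<alpha> a) (\<alpha> b) \<and> \<alpha> (a \<circ> b) = \<alpha> a \<circ> \<alpha> b) \<and>
     (\<forall>a\<in>A. \<forall>c. \<alpha> (oscale c a) = oscale c (\<alpha> a)) \<and>
     (\<forall>a\<in>A. \<alpha> (adj V a) = adj V (\<alpha> a))"

definition preflow :: "(nat \<Rightarrow> 'a set) \<Rightarrow> 'a op set \<Rightarrow> (real \<Rightarrow> 'a op \<Rightarrow> 'a op) \<Rightarrow> bool" where
  "preflow V A \<sigma> \<longleftrightarrow> (\<forall>t. star_aut V A (\<sigma> t)) \<and> (\<forall>a\<in>A. \<sigma> 0 a = a) \<and>
     (\<forall>s t. \<forall>a\<in>A. \<sigma> (s + t) a = \<sigma> s (\<sigma> t a))"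

definition norm_continuous :: "(nat \<Rightarrow> 'a set) \<Rightarrow> (real \<Rightarrow> 'a op) \<Rightarrow> bool" where
  "norm_continuous V u \<longleftrightarrow>
     (\<forall>t0. \<forall>e>0. \<exists>\<delta>>0. \<forall>t. \<bar>t - t0\<bar> < \<delta> \<longrightarrow> opnorm V (odiff (u t) (u t0)) < e)"

definition flow :: "(nat \<Rightarrow> 'a set) \<Rightarrow> 'a op set \<Rightarrow> (real \<Rightarrow> 'a op \<Rightarrow> 'a op) \<Rightarrow> bool" where
  "flow V A \<sigma> \<longleftrightarrow> preflow V A \<sigma> \<and> (\<forall>a\<in>A. norm_continuous V (\<lambda>t. \<sigma> t a))"

definition unitary_in :: "(nat \<Rightarrow> 'a set) \<Rightarrow> 'a op set \<Rightarrow> 'a op \<Rightarrow> bool" where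
  "unitary_in V A u \<longleftrightarrow> u \<in> A \<and> u \<circ> adj V u = oid V \<and> adj V u \<circ> u = oid V"

definition cocycle :: "(nat \<Rightarrow> 'a set) \<Rightarrow> 'a op set \<Rightarrow> (real \<Rightarrow> 'a op \<Rightarrow> 'a op) \<Rightarrow> (real \<Rightarrow> 'a op) \<Rightarrow> bool" where
  "cocycle V A \<sigma> u \<longleftrightarrow> (\<forall>t. unitary_in V A (u t)) \<and> norm_continuous V u \<and>
     (\<forall>s t. u (t + s) = u t \<circ> \<sigma> t (u s))"

definition cocycle_perturbation_of ::
  "(nat \<Rightarrow> 'a set) \<Rightarrow> 'a op set \<Rightarrow> (real \<Rightarrow> 'a op \<Rightarrow> 'a op) \<Rightarrow> (real \<Rightarrow> 'a op \<Rightarrow> 'a op) \<Rightarrow> bool" where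
  "cocycle_perturbation_of V A \<rho> \<sigma> \<longleftrightarrow>
     (\<exists>u. cocycle V A \<sigma> u \<and> (\<forall>t. \<forall>a\<in>A. \<rho> t a = u t \<circ> \<sigma> t a \<circ> adj V (u t)))"

definition avgproj :: "(nat \<Rightarrow> 'a set) \<Rightarrow> nat \<Rightarrow> 'a op" where
  "avgproj V n = (\<lambda>\<xi> z. if \<xi> \<in> l2 V \<and> z \<in> Xc V \<and> fst z = n
      then (\<Sum>y\<in>V n. \<xi> (n, y)) / of_nat (card (V n)) else 0)"

text \<open>e^{ith} for h = SOT-sum_n w(n) p_n: on each l2(X_n) it equals
  1 + (e^{itw(n)} - 1) p_n.\<close>
definition exp_ith :: "(nat \<Rightarrow> 'a set) \<Rightarrow> (nat \<Rightarrow> real) \<Rightarrow> real \<Rightarrow> 'a op" where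
  "exp_ith V w t = (\<lambda>\<xi> z. oid V \<xi> z + (exp (\<i> * of_real (t * w (fst z))) - 1) * avgproj V (fst z) \<xi> z)"

definition sigma_h :: "(nat \<Rightarrow> 'a set) \<Rightarrow> (nat \<Rightarrow> real) \<Rightarrow> real \<Rightarrow> 'a op \<Rightarrow> 'a op" where
  "sigma_h V w t a = exp_ith V w t \<circ> a \<circ> exp_ith V w (- t)"

definition exp_itk :: "(nat \<Rightarrow> 'a set) \<Rightarrow> (nat \<times> 'a \<Rightarrow> real) \<Rightarrow> real \<Rightarrow> 'a op" where
  "exp_itk V k t = (\<lambda>\<xi> z. exp (\<i> * of_real (t * k z)) * oid V \<xi> z)"

definition sigma_diag :: "(nat \<Rightarrow> 'a set) \<Rightarrow> (nat \<times> 'a \<Rightarrow> real) \<Rightarrow> real \<Rightarrow> 'a op \<Rightarrow> 'a op" where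
  "sigma_diag V k t a = exp_itk V k t \<circ> a \<circ> exp_itk V k (- t)"

end

theory Submission
  imports Defs
begin

text \<open>
  The discrete Cheeger inequality bounds the spectral gap of the graph Laplacians of the blocks from
  below, so the powers of a lazy random walk operator, which has finite propagation, converge in
  norm to the sum \<open>P\<close> of all averaging projections. Hence \<open>P\<close> lies in the uniform Roe algebra, and so
  does \<open>exp(ith) = 1 + z P\<close>, where \<open>z\<close> is multiplication by \<open>exp(itw(n)) - 1\<close>; thus \<open>\<sigma>\<^sub>h\<close> is a pre-flow
  by inner automorphisms. If \<open>w\<close> is unbounded, then at arbitrarily small times \<open>t\<close> some large block
  has \<open>t w(n) = \<pi>\<close>, and there \<open>exp(ith)\<close> is the reflection \<open>1 - 2 p\<^sub>n\<close>. It moves the projection onto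
  half of the block by a fixed amount, so \<open>\<sigma>\<^sub>h\<close> is not a flow. It also stays at a fixed distance from
  every diagonal unitary, since it almost fixes unit vectors, yet negates the constant vector;
  this excludes cocycle perturbations of diagonal pre-flows.
\<close>

subsection \<open>The Hilbert space\<close>

text \<open>The argument works with matrix coefficients and block means and uses no functional
  calculus. The obstacle is that averaging projections are nearly invisible entrywise: the
  coefficients of \<open>p_n\<close> are 1/|X_n|, which tend to 0, although \<open>p_n\<close> has
  norm 1. So neither membership of \<open>P\<close> in the algebra nor discontinuity can be read off
  single entries. Membership needs one contraction rate valid on all blocks at once, and this is
  where uniformity of the degree bound and of the Cheeger constant enters. Discontinuity needs a
  test vector spread over a whole block. For cocycles, the perturbation identity is applied only to
  rank-one diagonal projections. It says that exp(-ith) u_t commutes with each of them, hence u_t =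
  exp(ith) M with M diagonal. Norm continuity at 0 is then used twice at the same time t: on the
  diagonal entries, which determine M up to a small error, and on the constant vector, where the
  resulting value is incompatible with u_t being close to 1.\<close>

lemma l2D_outside: "\<xi> \<in> l2 V \<Longrightarrow> z \<notin> Xc V \<Longrightarrow> \<xi> z = 0"
  unfolding l2_def by blast

lemma l2_summable: "\<xi> \<in> l2 V \<Longrightarrow> (\<lambda>z. (cmod (\<xi> z))\<^sup>2) summable_on Xc V"
  by (simp add: l2_def)

lemma l2norm_nonneg [simp]: "0 \<le> l2norm V \<xi>"
  by (simp add: l2norm_def infsum_nonneg)

lemma l2norm_sq: "(l2norm V \<xi>)\<^sup>2 = infsum (\<lambda>z. (cmod (\<xi> z))\<^sup>2) (Xc V)"
  by (simp add: l2norm_def infsum_nonneg)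

lemma sum_le_l2norm_sq:
  assumes "\<xi> \<in> l2 V" "finite F" "F \<subseteq> Xc V"
  shows "(\<Sum>z\<in>F. (cmod (\<xi> z))\<^sup>2) \<le> (l2norm V \<xi>)\<^sup>2"
  unfolding l2norm_sq using assms by (intro finite_sum_le_infsum l2_summable) auto

lemma L2_set_le_l2norm:
  assumes "\<xi> \<in> l2 V" "finite F" "F \<subseteq> Xc V"
  shows "L2_set (\<lambda>z. cmod (\<xi> z)) F \<le> l2norm V \<xi>"
  using sum_le_l2norm_sq[OF assms] by (simp add: L2_set_def real_le_lsqrt sum_nonneg)

lemma cmod_le_l2norm:
  assumes "\<xi> \<in> l2 V" shows "cmod (\<xi> z) \<le> l2norm V \<xi>"
proof (cases "z \<in> Xc V")
  case True
  then show ?thesis using L2_set_le_l2norm[OF assms, of "{z}"] by simp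
qed (simp add: l2D_outside[OF assms])

text \<open>Membership and norm bounds are both reduced to finite sets, where the Minkowski and
  Cauchy-Schwarz inequalities for \<open>L2_set\<close> apply. The instance with the empty set shows
  that \<open>C\<close> is nonnegative.\<close>

lemma
  assumes out: "\<And>z. z \<notin> Xc V \<Longrightarrow> \<xi> z = 0"
    and le: "\<And>F. finite F \<Longrightarrow> F \<subseteq> Xc V \<Longrightarrow> L2_set (\<lambda>z. cmod (\<xi> z)) F \<le> C"
  shows l2I: "\<xi> \<in> l2 V" and l2norm_leI: "l2norm V \<xi> \<le> C"
proof -
  have C: "0 \<le> C" using le[of "{}"] by simp
  have b: "(\<Sum>z\<in>F. (cmod (\<xi> z))\<^sup>2) \<le> C\<^sup>2" if "finite F" "F \<subseteq> Xc V" for F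
    using le[OF that] C by (simp add: L2_set_def sqrt_le_D)
  have s: "(\<lambda>z. (cmod (\<xi> z))\<^sup>2) summable_on Xc V"
    by (rule nonneg_bdd_above_summable_on) (auto intro!: bdd_aboveI[of _ "C\<^sup>2"] b)
  then show "\<xi> \<in> l2 V" using out by (simp add: l2_def)
  have "infsum (\<lambda>z. (cmod (\<xi> z))\<^sup>2) (Xc V) \<le> C\<^sup>2"
    using s b by (rule infsum_le_finite_sums)
  then show "l2norm V \<xi> \<le> C" using C by (simp add: l2norm_def real_le_lsqrt)
qed

lemma l2_zero [simp]: "(\<lambda>_. 0) \<in> l2 V" "l2norm V (\<lambda>_. 0) = 0"
  by (simp_all add: l2_def l2norm_def)

lemma
  assumes "\<xi> \<in> l2 V" "\<eta> \<in> l2 V"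
  shows l2_add: "(\<lambda>z. \<xi> z + \<eta> z) \<in> l2 V"
    and l2norm_triangle: "l2norm V (\<lambda>z. \<xi> z + \<eta> z) \<le> l2norm V \<xi> + l2norm V \<eta>"
proof -
  have "L2_set (\<lambda>z. cmod (\<xi> z + \<eta> z)) F \<le> l2norm V \<xi> + l2norm V \<eta>" if "finite F" "F \<subseteq> Xc V" for F
  proof -
    have "L2_set (\<lambda>z. cmod (\<xi> z + \<eta> z)) F \<le> L2_set (\<lambda>z. cmod (\<xi> z) + cmod (\<eta> z)) F"
      by (intro L2_set_mono norm_triangle_ineq) auto
    also have "\<dots> \<le> L2_set (\<lambda>z. cmod (\<xi> z)) F + L2_set (\<lambda>z. cmod (\<eta> z)) F"
      by (rule L2_set_triangle_ineq)
    finally show ?thesis using L2_set_le_l2norm[OF assms(1) that] L2_set_le_l2norm[OF assms(2) that] by simp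
  qed
  moreover have "\<xi> z + \<eta> z = 0" if "z \<notin> Xc V" for z using assms that by (simp add: l2D_outside)
  ultimately show "(\<lambda>z. \<xi> z + \<eta> z) \<in> l2 V" "l2norm V (\<lambda>z. \<xi> z + \<eta> z) \<le> l2norm V \<xi> + l2norm V \<eta>"
    using l2I[of V "\<lambda>z. \<xi> z + \<eta> z"] l2norm_leI[of V "\<lambda>z. \<xi> z + \<eta> z"] by metis+
qed

lemma
  assumes "\<xi> \<in> l2 V" "\<And>z. cmod (\<eta> z) \<le> C * cmod (\<xi> z)" "0 \<le> C"
  shows l2_dominated: "\<eta> \<in> l2 V" and l2norm_dominated: "l2norm V \<eta> \<le> C * l2norm V \<xi>"
proof -
  have "L2_set (\<lambda>z. cmod (\<eta> z)) F \<le> C * l2norm V \<xi>" if "finite F" "F \<subseteq> Xc V" for F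
  proof -
    have "L2_set (\<lambda>z. cmod (\<eta> z)) F \<le> L2_set (\<lambda>z. C * cmod (\<xi> z)) F"
      by (intro L2_set_mono assms) auto
    also have "\<dots> = C * L2_set (\<lambda>z. cmod (\<xi> z)) F" using assms(3) by (simp add: L2_set_right_distrib)
    finally show ?thesis using L2_set_le_l2norm[OF assms(1) that] assms(3) by (meson mult_left_mono order_trans)
  qed
  moreover have "\<eta> z = 0" if "z \<notin> Xc V" for z
    using assms(2)[of z] l2D_outside[OF assms(1) that] by simp
  ultimately show "\<eta> \<in> l2 V" "l2norm V \<eta> \<le> C * l2norm V \<xi>"
    using l2I[of V \<eta>] l2norm_leI[of V \<eta>] by metis+
qed

lemma l2_scale: "\<xi> \<in> l2 V \<Longrightarrow> (\<lambda>z. c * \<xi> z) \<in> l2 V"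
  by (erule l2_dominated[where C = "cmod c"]) (simp_all add: norm_mult)

lemma l2norm_scale:
  assumes "\<xi> \<in> l2 V" shows "l2norm V (\<lambda>z. c * \<xi> z) = cmod c * l2norm V \<xi>"
  by (simp add: l2norm_def norm_mult power_mult_distrib infsum_cmult_right' real_sqrt_mult)

lemma l2_lincomb: "\<xi> \<in> l2 V \<Longrightarrow> \<eta> \<in> l2 V \<Longrightarrow> (\<lambda>z. c * \<xi> z + \<eta> z) \<in> l2 V"
  by (simp add: l2_add l2_scale)

lemma l2_diff: "\<xi> \<in> l2 V \<Longrightarrow> \<eta> \<in> l2 V \<Longrightarrow> (\<lambda>z. \<xi> z - \<eta> z) \<in> l2 V"
  using l2_lincomb[of \<eta> V \<xi> "-1"] by simp

lemma l2_finite_support: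
  assumes "finite F" "F \<subseteq> Xc V" "\<And>z. z \<notin> F \<Longrightarrow> \<xi> z = 0"
  shows "\<xi> \<in> l2 V" "(l2norm V \<xi>)\<^sup>2 = (\<Sum>z\<in>F. (cmod (\<xi> z))\<^sup>2)"
proof -
  have "((\<lambda>z. (cmod (\<xi> z))\<^sup>2) has_sum (\<Sum>z\<in>F. (cmod (\<xi> z))\<^sup>2)) (Xc V)"
    by (rule has_sum_cong_neutral[THEN iffD1, OF _ _ _ has_sum_finite[OF assms(1)]])
       (use assms in auto)
  then show "\<xi> \<in> l2 V" "(l2norm V \<xi>)\<^sup>2 = (\<Sum>z\<in>F. (cmod (\<xi> z))\<^sup>2)"
    using assms by (auto simp: l2_def l2norm_sq infsumI summable_on_def)
qed

definition unit_vec :: "nat \<times> 'a \<Rightarrow> 'a vec" where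
  "unit_vec x = (\<lambda>z. if z = x then 1 else 0)"

lemma unit_vec_l2: "x \<in> Xc V \<Longrightarrow> unit_vec x \<in> l2 V"
  by (rule l2_finite_support[of "{x}"]) (auto simp: unit_vec_def)

lemma l2norm_unit_vec: "x \<in> Xc V \<Longrightarrow> l2norm V (unit_vec x) = 1"
  using l2_finite_support(2)[of "{x}" V "unit_vec x"] l2norm_nonneg[of V "unit_vec x"]
  by (auto simp: unit_vec_def power2_eq_1_iff simp del: l2norm_nonneg)

definition trunc :: "(nat \<times> 'a) set \<Rightarrow> 'a vec \<Rightarrow> 'a vec" where
  "trunc F \<xi> = (\<lambda>z. if z \<in> F then \<xi> z else 0)"

lemma trunc_l2: "\<xi> \<in> l2 V \<Longrightarrow> trunc F \<xi> \<in> l2 V"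
  by (erule l2_dominated[where C = 1]) (simp_all add: trunc_def)

text \<open>The squared error is the tail of a convergent sum. The limit is taken along finite
  subsets, the filter underlying \<open>has_sum\<close>, so that it combines directly with the
  expansion of operators in unit vectors.\<close>

lemma trunc_tendsto:
  assumes "\<xi> \<in> l2 V"
  shows "((\<lambda>F. l2norm V (\<lambda>z. \<xi> z - trunc F \<xi> z)) \<longlongrightarrow> 0) (finite_subsets_at_top (Xc V))"
proof -
  let ?f = "\<lambda>z. (cmod (\<xi> z))\<^sup>2"
  have eq: "(l2norm V (\<lambda>z. \<xi> z - trunc F \<xi> z))\<^sup>2 = infsum ?f (Xc V) - sum ?f F"
    if F: "finite F" "F \<subseteq> Xc V" for F
  proof -
    have "infsum ?f (Xc V) = infsum ?f F + infsum ?f (Xc V - F)"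
      using infsum_Un_disjoint[of ?f F "Xc V - F"] l2_summable[OF assms] F
      by (simp add: Un_absorb1 summable_on_Diff)
    moreover have "infsum ?f (Xc V - F) = infsum (\<lambda>z. (cmod (\<xi> z - trunc F \<xi> z))\<^sup>2) (Xc V)"
      by (rule infsum_cong_neutral) (auto simp: trunc_def)
    ultimately show ?thesis using F by (simp add: l2norm_sq)
  qed
  have "((\<lambda>F. infsum ?f (Xc V) - sum ?f F) \<longlongrightarrow> infsum ?f (Xc V) - infsum ?f (Xc V)) (finite_subsets_at_top (Xc V))"
    by (intro tendsto_intros infsum_tendsto l2_summable assms)
  then have "((\<lambda>F. sqrt (infsum ?f (Xc V) - sum ?f F)) \<longlongrightarrow> 0) (finite_subsets_at_top (Xc V))"
    using tendsto_real_sqrt by fastforce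
  moreover have "\<forall>\<^sub>F F in finite_subsets_at_top (Xc V). sqrt (infsum ?f (Xc V) - sum ?f F) = l2norm V (\<lambda>z. \<xi> z - trunc F \<xi> z)"
    by (rule eventually_finite_subsets_at_top_weakI) (simp add: eq[symmetric])
  ultimately show ?thesis by (rule Lim_transform_eventually)
qed

lemma
  assumes "\<xi> \<in> l2 V" "\<eta> \<in> l2 V"
  shows l2inner_abs_summable: "(\<lambda>z. cmod (cnj (\<xi> z) * \<eta> z)) summable_on Xc V"
    and l2inner_le: "cmod (l2inner V \<xi> \<eta>) \<le> l2norm V \<xi> * l2norm V \<eta>"
proof -
  have b: "(\<Sum>z\<in>F. cmod (cnj (\<xi> z) * \<eta> z)) \<le> l2norm V \<xi> * l2norm V \<eta>" if "finite F" "F \<subseteq> Xc V" for F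
  proof -
    have "(\<Sum>z\<in>F. cmod (cnj (\<xi> z) * \<eta> z)) \<le> L2_set (\<lambda>z. cmod (\<xi> z)) F * L2_set (\<lambda>z. cmod (\<eta> z)) F"
      using L2_set_mult_ineq[of "\<lambda>z. cmod (\<xi> z)" "\<lambda>z. cmod (\<eta> z)" F] by (simp add: norm_mult)
    also have "\<dots> \<le> l2norm V \<xi> * l2norm V \<eta>"
      by (intro mult_mono L2_set_le_l2norm assms that) auto
    finally show ?thesis .
  qed
  show s: "(\<lambda>z. cmod (cnj (\<xi> z) * \<eta> z)) summable_on Xc V"
    by (rule nonneg_bdd_above_summable_on) (auto intro!: bdd_aboveI b)
  have "cmod (l2inner V \<xi> \<eta>) \<le> infsum (\<lambda>z. cmod (cnj (\<xi> z) * \<eta> z)) (Xc V)"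
    unfolding l2inner_def using s by (rule norm_infsum_bound)
  also have "\<dots> \<le> l2norm V \<xi> * l2norm V \<eta>" using s b by (rule infsum_le_finite_sums)
  finally show "cmod (l2inner V \<xi> \<eta>) \<le> l2norm V \<xi> * l2norm V \<eta>" .
qed

lemma l2inner_summable: "\<xi> \<in> l2 V \<Longrightarrow> \<eta> \<in> l2 V \<Longrightarrow> (\<lambda>z. cnj (\<xi> z) * \<eta> z) summable_on Xc V"
  by (rule abs_summable_summable[OF l2inner_abs_summable])

lemma l2inner_commute: "l2inner V \<eta> \<xi> = cnj (l2inner V \<xi> \<eta>)"
  unfolding l2inner_def infsum_cnj[symmetric] by (simp add: mult.commute)

lemma l2inner_lincomb_right:
  assumes "\<zeta> \<in> l2 V" "\<xi> \<in> l2 V" "\<eta> \<in> l2 V"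
  shows "l2inner V \<zeta> (\<lambda>z. c * \<xi> z + \<eta> z) = c * l2inner V \<zeta> \<xi> + l2inner V \<zeta> \<eta>"
proof -
  have "l2inner V \<zeta> (\<lambda>z. c * \<xi> z + \<eta> z) = infsum (\<lambda>z. c * (cnj (\<zeta> z) * \<xi> z) + cnj (\<zeta> z) * \<eta> z) (Xc V)"
    by (simp add: l2inner_def algebra_simps)
  also have "\<dots> = c * l2inner V \<zeta> \<xi> + l2inner V \<zeta> \<eta>"
    unfolding l2inner_def using assms
    by (subst infsum_add) (auto simp: infsum_cmult_right' intro!: l2inner_summable summable_on_cmult_right)
  finally show ?thesis .
qed

lemma l2inner_unit_vec_left:
  assumes "x \<in> Xc V" shows "l2inner V (unit_vec x) \<eta> = \<eta> x"
proof -
  have "l2inner V (unit_vec x) \<eta> = infsum \<eta> {x}"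
    unfolding l2inner_def by (rule infsum_cong_neutral) (use assms in \<open>auto simp: unit_vec_def\<close>)
  then show ?thesis by simp
qed

lemma l2inner_unit_vec_right: "x \<in> Xc V \<Longrightarrow> l2inner V \<xi> (unit_vec x) = cnj (\<xi> x)"
  by (subst l2inner_commute) (simp add: l2inner_unit_vec_left)

subsection \<open>Bounded operators\<close>

lemma bopI:
  assumes "\<And>\<xi>. \<xi> \<notin> l2 V \<Longrightarrow> T \<xi> = (\<lambda>_. 0)"
    and "\<And>\<xi> \<eta> c z. \<xi> \<in> l2 V \<Longrightarrow> \<eta> \<in> l2 V \<Longrightarrow> T (\<lambda>z. c * \<xi> z + \<eta> z) z = c * T \<xi> z + T \<eta> z"
    and "\<And>\<xi>. \<xi> \<in> l2 V \<Longrightarrow> T \<xi> \<in> l2 V"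
    and "\<And>\<xi>. \<xi> \<in> l2 V \<Longrightarrow> l2norm V (T \<xi>) \<le> C * l2norm V \<xi>"
  shows "bop V T"
  unfolding bop_def using assms by (auto intro!: exI[of _ C])

lemma bop_outside: "bop V T \<Longrightarrow> \<xi> \<notin> l2 V \<Longrightarrow> T \<xi> = (\<lambda>_. 0)"
  by (simp add: bop_def)

lemma bop_l2: "bop V T \<Longrightarrow> T \<xi> \<in> l2 V"
  by (cases "\<xi> \<in> l2 V") (simp_all add: bop_def)

lemma bop_lincomb:
  "bop V T \<Longrightarrow> \<xi> \<in> l2 V \<Longrightarrow> \<eta> \<in> l2 V \<Longrightarrow> T (\<lambda>z. c * \<xi> z + \<eta> z) = (\<lambda>z. c * T \<xi> z + T \<eta> z)"
  by (simp add: bop_def)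

lemma bop_zero: assumes "bop V T" shows "T (\<lambda>_. 0) = (\<lambda>_. 0)"
  using bop_lincomb[OF assms, of "\<lambda>_. 0" "\<lambda>_. 0" "-1"] by simp

lemma bop_scale: "bop V T \<Longrightarrow> \<xi> \<in> l2 V \<Longrightarrow> T (\<lambda>z. c * \<xi> z) = (\<lambda>z. c * T \<xi> z)"
  using bop_lincomb[of V T \<xi> "\<lambda>_. 0" c] by (simp add: bop_zero)

lemma bop_add: "bop V T \<Longrightarrow> \<xi> \<in> l2 V \<Longrightarrow> \<eta> \<in> l2 V \<Longrightarrow> T (\<lambda>z. \<xi> z + \<eta> z) = (\<lambda>z. T \<xi> z + T \<eta> z)"
  using bop_lincomb[of V T \<xi> \<eta> 1] by simp

lemma bop_diff: "bop V T \<Longrightarrow> \<xi> \<in> l2 V \<Longrightarrow> \<eta> \<in> l2 V \<Longrightarrow> T (\<lambda>z. \<xi> z - \<eta> z) = (\<lambda>z. T \<xi> z - T \<eta> z)"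
  using bop_lincomb[of V T \<eta> \<xi> "-1"] by simp

lemma l2_sum: "finite I \<Longrightarrow> (\<And>i. i \<in> I \<Longrightarrow> f i \<in> l2 V) \<Longrightarrow> (\<lambda>z. \<Sum>i\<in>I. f i z) \<in> l2 V"
  by (induction rule: finite_induct) (auto intro: l2_add)

lemma bop_sum:
  assumes "bop V T" "finite I" "\<And>i. i \<in> I \<Longrightarrow> f i \<in> l2 V"
  shows "T (\<lambda>z. \<Sum>i\<in>I. f i z) = (\<lambda>z. \<Sum>i\<in>I. T (f i) z)"
  using assms(2,3) by (induction rule: finite_induct) (auto simp: bop_zero[OF assms(1)] bop_add[OF assms(1)] l2_sum)

lemma bop_bound:
  assumes "bop V T"
  shows "\<exists>C\<ge>0. \<forall>\<xi>. l2norm V (T \<xi>) \<le> C * l2norm V \<xi>"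
proof -
  from assms obtain C where C: "\<forall>\<xi>\<in>l2 V. l2norm V (T \<xi>) \<le> C * l2norm V \<xi>" by (auto simp: bop_def)
  have "l2norm V (T \<xi>) \<le> max C 0 * l2norm V \<xi>" for \<xi>
  proof (cases "\<xi> \<in> l2 V")
    case True
    then have "l2norm V (T \<xi>) \<le> C * l2norm V \<xi>" using C by blast
    also have "\<dots> \<le> max C 0 * l2norm V \<xi>" by (intro mult_right_mono) auto
    finally show ?thesis .
  qed (simp add: bop_outside[OF assms])
  then show ?thesis by (intro exI[of _ "max C 0"]) simp
qed

lemma opnorm_leI:
  assumes "\<And>\<xi>. \<xi> \<in> l2 V \<Longrightarrow> l2norm V (T \<xi>) \<le> C * l2norm V \<xi>" "0 \<le> C"
  shows "opnorm V T \<le> C"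
  unfolding opnorm_def
proof (rule cSup_least)
  show "{l2norm V (T \<xi>) |\<xi>. \<xi> \<in> l2 V \<and> l2norm V \<xi> \<le> 1} \<noteq> {}"
    by (auto intro!: exI[of _ "\<lambda>_. 0"])
  show "x \<le> C" if "x \<in> {l2norm V (T \<xi>) |\<xi>. \<xi> \<in> l2 V \<and> l2norm V \<xi> \<le> 1}" for x
  proof -
    from that obtain \<xi> where x: "x = l2norm V (T \<xi>)" "\<xi> \<in> l2 V" "l2norm V \<xi> \<le> 1" by auto
    have "x \<le> C * l2norm V \<xi>" using assms(1) x by simp
    also have "\<dots> \<le> C * 1" using x assms(2) by (intro mult_left_mono) auto
    finally show ?thesis by simp
  qed
qed

lemma l2norm_le_opnorm:
  assumes "bop V T" "\<xi> \<in> l2 V"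
  shows "l2norm V (T \<xi>) \<le> opnorm V T * l2norm V \<xi>"
proof (cases "l2norm V \<xi> = 0")
  case True
  then show ?thesis using bop_bound[OF assms(1)] by (metis mult_zero_right)
next
  case False
  then have pos: "0 < l2norm V \<xi>" by (simp add: order_less_le)
  obtain C where C: "0 \<le> C" "\<And>\<xi>. l2norm V (T \<xi>) \<le> C * l2norm V \<xi>" using bop_bound[OF assms(1)] by blast
  define \<eta> where "\<eta> = (\<lambda>z. of_real (1 / l2norm V \<xi>) * \<xi> z)"
  have \<eta>: "\<eta> \<in> l2 V" "l2norm V \<eta> = 1"
    unfolding \<eta>_def using pos by (simp_all only: l2_scale assms(2) l2norm_scale) (simp add: norm_divide)
  have "l2norm V (T \<eta>) = l2norm V (T \<xi>) / l2norm V \<xi>"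
    unfolding \<eta>_def bop_scale[OF assms] using pos
    by (simp add: l2norm_scale bop_l2[OF assms(1)] norm_divide del: of_real_divide)
  moreover have "l2norm V (T \<eta>) \<le> opnorm V T"
    unfolding opnorm_def
  proof (rule cSup_upper)
    show "bdd_above {l2norm V (T \<xi>) |\<xi>. \<xi> \<in> l2 V \<and> l2norm V \<xi> \<le> 1}"
    proof (rule bdd_aboveI[of _ C], safe)
      fix \<zeta> assume "l2norm V \<zeta> \<le> 1"
      then show "l2norm V (T \<zeta>) \<le> C"
        using C(2)[of \<zeta>] C(1) by (meson mult_left_le order_trans)
    qed
  qed (use \<eta> in auto)
  ultimately show ?thesis using pos by (simp add: divide_le_eq)
qed

lemma bop_oid: "bop V (oid V)"
  by (rule bopI[where C = 1]) (auto simp: oid_def l2_lincomb)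

lemma bop_oadd:
  assumes "bop V T" "bop V S" shows "bop V (oadd T S)"
proof -
  obtain C where C: "\<And>\<xi>. l2norm V (T \<xi>) \<le> C * l2norm V \<xi>" using bop_bound[OF assms(1)] by blast
  obtain C' where C': "\<And>\<xi>. l2norm V (S \<xi>) \<le> C' * l2norm V \<xi>" using bop_bound[OF assms(2)] by blast
  show ?thesis
  proof (rule bopI[where C = "C + C'"])
    fix \<xi> assume "\<xi> \<in> l2 V"
    have "l2norm V (oadd T S \<xi>) \<le> l2norm V (T \<xi>) + l2norm V (S \<xi>)"
      unfolding oadd_def by (intro l2norm_triangle bop_l2 assms)
    then show "l2norm V (oadd T S \<xi>) \<le> (C + C') * l2norm V \<xi>"
      using C[of \<xi>] C'[of \<xi>] by (simp add: algebra_simps)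
  qed (auto simp: oadd_def bop_lincomb[OF assms(1)] bop_lincomb[OF assms(2)] distrib_left
      bop_outside[OF assms(1)] bop_outside[OF assms(2)] intro!: l2_add bop_l2[OF assms(1)] bop_l2[OF assms(2)])
qed

lemma bop_oscale:
  assumes "bop V T" shows "bop V (oscale c T)"
proof -
  obtain C where C: "\<And>\<xi>. l2norm V (T \<xi>) \<le> C * l2norm V \<xi>" using bop_bound[OF assms(1)] by blast
  show ?thesis
  proof (rule bopI[where C = "cmod c * C"])
    fix \<xi> assume "\<xi> \<in> l2 V"
    show "l2norm V (oscale c T \<xi>) \<le> cmod c * C * l2norm V \<xi>"
      using mult_left_mono[OF C[of \<xi>] norm_ge_zero[of c]]
      by (simp add: oscale_def l2norm_scale bop_l2[OF assms] mult.assoc)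
  qed (auto simp: oscale_def bop_lincomb[OF assms] distrib_left mult.left_commute
      bop_outside[OF assms] intro!: l2_scale bop_l2[OF assms])
qed

lemma odiff_eq: "odiff T S = oadd T (oscale (-1) S)"
  by (simp add: odiff_def oadd_def oscale_def)

lemma bop_odiff: "bop V T \<Longrightarrow> bop V S \<Longrightarrow> bop V (odiff T S)"
  by (simp add: odiff_eq bop_oadd bop_oscale)

lemma bop_comp:
  assumes "bop V T" "bop V S" shows "bop V (T \<circ> S)"
proof -
  obtain C where C: "0 \<le> C" "\<And>\<xi>. l2norm V (T \<xi>) \<le> C * l2norm V \<xi>" using bop_bound[OF assms(1)] by blast
  obtain C' where C': "\<And>\<xi>. l2norm V (S \<xi>) \<le> C' * l2norm V \<xi>" using bop_bound[OF assms(2)] by blast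
  show ?thesis
  proof (rule bopI[where C = "C * C'"])
    fix \<xi> assume "\<xi> \<in> l2 V"
    show "l2norm V ((T \<circ> S) \<xi>) \<le> C * C' * l2norm V \<xi>"
      using C(2)[of "S \<xi>"] mult_left_mono[OF C'[of \<xi>] C(1)] by simp
  qed (auto simp: bop_lincomb[OF assms(1)] bop_lincomb[OF assms(2)] bop_zero[OF assms(1)]
      bop_outside[OF assms(2)] bop_l2[OF assms(2)] bop_l2[OF assms(1)])
qed

lemma oid_comp: "bop V T \<Longrightarrow> oid V \<circ> T = T" "bop V T \<Longrightarrow> T \<circ> oid V = T"
  by (auto simp: oid_def bop_l2 bop_outside bop_zero fun_eq_iff)

text \<open>A partial sum is the same inner product with \<open>\<xi>\<close> replaced by its
  truncation, and boundedness of \<open>T\<close> turns convergence of truncations into convergence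
  of the sum. This stands in for an orthonormal basis expansion; uniqueness of operators and
  existence of adjoints both rest on it.\<close>

lemma bop_has_sum:
  assumes T: "bop V T" and "\<xi> \<in> l2 V" "\<eta> \<in> l2 V"
  shows "((\<lambda>x. \<xi> x * l2inner V \<eta> (T (unit_vec x))) has_sum l2inner V \<eta> (T \<xi>)) (Xc V)"
proof -
  obtain C where C: "0 \<le> C" "\<And>\<xi>. l2norm V (T \<xi>) \<le> C * l2norm V \<xi>" using bop_bound[OF T] by blast
  let ?s = "\<lambda>F. \<Sum>x\<in>F. \<xi> x * l2inner V \<eta> (T (unit_vec x))"
  have eq: "?s F = l2inner V \<eta> (T (trunc F \<xi>))" if F: "finite F" "F \<subseteq> Xc V" for F
    using F
  proof (induction rule: finite_induct)
    case empty
    then show ?case by (simp add: trunc_def bop_zero[OF T] l2inner_def)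
  next
    case (insert x F)
    have "trunc (insert x F) \<xi> = (\<lambda>z. \<xi> x * unit_vec x z + trunc F \<xi> z)"
      using insert by (auto simp: trunc_def unit_vec_def)
    with insert show ?case
      by (simp add: bop_lincomb[OF T] unit_vec_l2 trunc_l2 assms l2inner_lincomb_right bop_l2[OF T])
  qed
  have b: "norm (?s F - l2inner V \<eta> (T \<xi>)) \<le> l2norm V (\<lambda>z. \<xi> z - trunc F \<xi> z) * (l2norm V \<eta> * C)"
    if F: "finite F" "F \<subseteq> Xc V" for F
  proof -
    have d: "(\<lambda>z. \<xi> z - trunc F \<xi> z) \<in> l2 V" by (intro l2_diff trunc_l2 assms)
    have "l2inner V \<eta> (T \<xi>) - ?s F = l2inner V \<eta> (T (\<lambda>z. \<xi> z - trunc F \<xi> z))"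
      using l2inner_lincomb_right[OF assms(3) bop_l2[OF T] bop_l2[OF T], of "-1" "trunc F \<xi>" \<xi>]
      by (simp add: eq[OF F] bop_diff[OF T] trunc_l2 assms)
    then have "norm (?s F - l2inner V \<eta> (T \<xi>)) \<le> l2norm V \<eta> * l2norm V (T (\<lambda>z. \<xi> z - trunc F \<xi> z))"
      using l2inner_le[OF assms(3) bop_l2[OF T]] by (metis norm_minus_commute)
    also have "\<dots> \<le> l2norm V \<eta> * (C * l2norm V (\<lambda>z. \<xi> z - trunc F \<xi> z))"
      by (intro mult_left_mono C) auto
    finally show ?thesis by (simp add: mult_ac)
  qed
  have "((\<lambda>F. ?s F - l2inner V \<eta> (T \<xi>)) \<longlongrightarrow> 0) (finite_subsets_at_top (Xc V))"
    by (rule Lim_null_comparison[OF _ tendsto_mult_left_zero[OF trunc_tendsto[OF assms(2)]]])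
       (rule eventually_finite_subsets_at_top_weakI, rule b)
  then show ?thesis unfolding has_sum_def by (simp add: LIM_zero_iff)
qed

text \<open>Matrix coefficients determine an operator. Full equality of functions results because
  bounded operators are zero at arguments outside \<open>l2 V\<close> and their values vanish off
  \<open>Xc V\<close>.\<close>

lemma bop_eqI:
  assumes "bop V T" "bop V S" "\<And>x. x \<in> Xc V \<Longrightarrow> T (unit_vec x) = S (unit_vec x)"
  shows "T = S"
proof (intro ext)
  fix \<xi> z
  show "T \<xi> z = S \<xi> z"
  proof (cases "\<xi> \<in> l2 V \<and> z \<in> Xc V")
    case True
    then have "l2inner V (unit_vec z) (T \<xi>) = l2inner V (unit_vec z) (S \<xi>)"
      by (intro has_sum_unique[OF bop_has_sum[OF assms(1)]]
          has_sum_cong[THEN iffD1, OF _ bop_has_sum[OF assms(2)]])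
         (auto simp: unit_vec_l2 assms(3))
    then show ?thesis using True by (simp add: l2inner_unit_vec_left)
  next
    case False
    then show ?thesis using bop_outside[OF assms(1)] bop_outside[OF assms(2)]
      bop_l2[OF assms(1)] bop_l2[OF assms(2)] l2D_outside by metis
  qed
qed

subsection \<open>Adjoints\<close>

definition adj_pair :: "(nat \<Rightarrow> 'a set) \<Rightarrow> 'a op \<Rightarrow> 'a op \<Rightarrow> bool" where
  "adj_pair V S T \<longleftrightarrow> (\<forall>\<xi>\<in>l2 V. \<forall>\<eta>\<in>l2 V. l2inner V (S \<xi>) \<eta> = l2inner V \<xi> (T \<eta>))"

lemma adj_pair_comp:
  "adj_pair V S T \<Longrightarrow> adj_pair V S' T' \<Longrightarrow> bop V S' \<Longrightarrow> bop V T \<Longrightarrow> adj_pair V (S \<circ> S') (T' \<circ> T)"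
  by (simp add: adj_pair_def bop_l2)

lemma adj_pair_unique:
  assumes "bop V S" "bop V S'" "adj_pair V S T" "adj_pair V S' T"
  shows "S = S'"
proof (rule bop_eqI[OF assms(1,2)], rule ext)
  fix x z assume x: "x \<in> Xc V"
  show "S (unit_vec x) z = S' (unit_vec x) z"
  proof (cases "z \<in> Xc V")
    case True
    have "l2inner V (S (unit_vec x)) (unit_vec z) = l2inner V (S' (unit_vec x)) (unit_vec z)"
      using assms(3,4) x True by (simp add: adj_pair_def unit_vec_l2)
    then show ?thesis using True by (simp add: l2inner_unit_vec_right)
  next
    case False
    then show ?thesis by (metis assms(1,2) bop_l2 l2D_outside)
  qed
qed

lemma adj_eqI: "bop V S \<Longrightarrow> adj_pair V S T \<Longrightarrow> adj V T = S"
  unfolding adj_def by (rule the_equality) (auto simp: adj_pair_def intro: adj_pair_unique)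

text \<open>The adjoint is read off the matrix coefficients of the operator; it is bounded because applying
  the operator to a finite truncation of the would-be image recovers the squared norm of that truncation.\<close>
lemma adj_exists:
  assumes T: "bop V T"
  obtains S where "bop V S" "adj_pair V S T"
proof -
  obtain C where C: "0 \<le> C" "\<And>\<xi>. l2norm V (T \<xi>) \<le> C * l2norm V \<xi>" using bop_bound[OF T] by blast
  define S where "S = (\<lambda>\<eta> z. if \<eta> \<in> l2 V \<and> z \<in> Xc V then l2inner V (T (unit_vec z)) \<eta> else 0)"
  have fin: "L2_set (\<lambda>z. cmod (S \<eta> z)) F \<le> C * l2norm V \<eta>"
    if \<eta>: "\<eta> \<in> l2 V" and F: "finite F" "F \<subseteq> Xc V" for \<eta> F
  proof -
    define \<zeta> where "\<zeta> = trunc F (S \<eta>)"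
    have \<zeta>: "\<zeta> \<in> l2 V" "(l2norm V \<zeta>)\<^sup>2 = (\<Sum>z\<in>F. (cmod (S \<eta> z))\<^sup>2)"
      using l2_finite_support[of F V \<zeta>] F by (auto simp: \<zeta>_def trunc_def)
    have "l2inner V \<eta> (T \<zeta>) = infsum (\<lambda>x. \<zeta> x * l2inner V \<eta> (T (unit_vec x))) (Xc V)"
      by (rule infsumI[symmetric, OF bop_has_sum[OF T \<zeta>(1) \<eta>]])
    also have "\<dots> = infsum (\<lambda>x. complex_of_real ((cmod (S \<eta> x))\<^sup>2)) F"
    proof (rule infsum_cong_neutral)
      fix x assume "x \<in> Xc V \<inter> F"
      then have "\<zeta> x = S \<eta> x" "l2inner V \<eta> (T (unit_vec x)) = cnj (S \<eta> x)"
        using \<eta> by (auto simp: \<zeta>_def trunc_def S_def l2inner_commute[of V \<eta>])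
      then show "\<zeta> x * l2inner V \<eta> (T (unit_vec x)) = complex_of_real ((cmod (S \<eta> x))\<^sup>2)"
        by (simp only: complex_norm_square)
    qed (use F in \<open>auto simp: \<zeta>_def trunc_def\<close>)
    finally have "l2inner V \<eta> (T \<zeta>) = complex_of_real ((l2norm V \<zeta>)\<^sup>2)" using F by (simp add: \<zeta>)
    then have "(l2norm V \<zeta>)\<^sup>2 = cmod (l2inner V \<eta> (T \<zeta>))" by (simp add: norm_power)
    also have "\<dots> \<le> l2norm V \<eta> * l2norm V (T \<zeta>)" by (intro l2inner_le \<eta> bop_l2[OF T])
    also have "\<dots> \<le> l2norm V \<eta> * (C * l2norm V \<zeta>)" by (intro mult_left_mono C) auto
    finally have "l2norm V \<zeta> * l2norm V \<zeta> \<le> (C * l2norm V \<eta>) * l2norm V \<zeta>"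
      by (simp add: power2_eq_square mult_ac)
    then have "l2norm V \<zeta> \<le> C * l2norm V \<eta>"
      using C(1) l2norm_nonneg[of V \<zeta>] by (cases "l2norm V \<zeta> = 0") (auto simp: mult_le_cancel_right)
    then show ?thesis using \<zeta>(2) by (metis L2_set_def l2norm_nonneg real_sqrt_unique)
  qed
  have "bop V S"
  proof (rule bopI[where C = C])
    show "S (\<lambda>z. c * \<xi> z + \<eta> z) z = c * S \<xi> z + S \<eta> z" if "\<xi> \<in> l2 V" "\<eta> \<in> l2 V" for \<xi> \<eta> c z
      using that by (simp add: S_def l2_lincomb l2inner_lincomb_right bop_l2[OF T])
    show "S \<xi> \<in> l2 V" "l2norm V (S \<xi>) \<le> C * l2norm V \<xi>" if "\<xi> \<in> l2 V" for \<xi>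
    proof -
      have "S \<xi> z = 0" if "z \<notin> Xc V" for z using that by (simp add: S_def)
      with fin[OF \<open>\<xi> \<in> l2 V\<close>] show "S \<xi> \<in> l2 V" "l2norm V (S \<xi>) \<le> C * l2norm V \<xi>"
        using l2I[of V "S \<xi>"] l2norm_leI[of V "S \<xi>"] by metis+
    qed
  qed (auto simp: S_def)
  moreover have "adj_pair V S T"
    unfolding adj_pair_def
  proof (intro ballI)
    fix \<eta> \<xi> assume h: "\<eta> \<in> l2 V" "\<xi> \<in> l2 V"
    have "l2inner V (S \<eta>) \<xi> = infsum (\<lambda>x. \<xi> x * l2inner V \<eta> (T (unit_vec x))) (Xc V)"
      unfolding l2inner_def[of V "S \<eta>"]
      by (rule infsum_cong) (simp add: S_def h l2inner_commute[of V \<eta>])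
    then show "l2inner V (S \<eta>) \<xi> = l2inner V \<eta> (T \<xi>)"
      using infsumI[OF bop_has_sum[OF T h(2,1)]] by simp
  qed
  ultimately show thesis by (rule that)
qed

lemma
  assumes "bop V T"
  shows bop_adj: "bop V (adj V T)" and adj_pair_adj: "adj_pair V (adj V T) T"
proof -
  obtain S where S: "bop V S" "adj_pair V S T" by (rule adj_exists[OF assms])
  then show "bop V (adj V T)" "adj_pair V (adj V T) T" by (simp_all add: adj_eqI)
qed

lemma adj_comp:
  assumes "bop V T" "bop V S" shows "adj V (T \<circ> S) = adj V S \<circ> adj V T"
  by (intro adj_eqI bop_comp bop_adj assms adj_pair_comp adj_pair_adj)

lemma adj_coeff:
  assumes "bop V T" "x \<in> Xc V" "y \<in> Xc V"
  shows "adj V T (unit_vec x) y = cnj (T (unit_vec y) x)"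
proof -
  have "l2inner V (adj V T (unit_vec x)) (unit_vec y) = l2inner V (unit_vec x) (T (unit_vec y))"
    using adj_pair_adj[OF assms(1)] assms by (simp add: adj_pair_def unit_vec_l2)
  then show ?thesis using assms by (simp add: l2inner_unit_vec_left l2inner_unit_vec_right complex_eq_iff)
qed

lemma adj_eqI_coeff:
  assumes "bop V T" "bop V S" "\<And>x y. x \<in> Xc V \<Longrightarrow> y \<in> Xc V \<Longrightarrow> S (unit_vec x) y = cnj (T (unit_vec y) x)"
  shows "adj V T = S"
proof (rule bop_eqI[OF bop_adj[OF assms(1)] assms(2)], rule ext)
  fix x z assume x: "x \<in> Xc V"
  show "adj V T (unit_vec x) z = S (unit_vec x) z"
  proof (cases "z \<in> Xc V")
    case True
    then show ?thesis using x assms by (simp add: adj_coeff)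
  next
    case False
    then show ?thesis by (metis assms(1,2) bop_adj bop_l2 l2D_outside)
  qed
qed


subsection \<open>The spectral gap of an expander\<close>

text \<open>A layer-cake argument by induction on the size of the support \<open>S\<close>. Lowering
  \<open>\<phi>\<close> on \<open>S\<close> by its least positive value \<open>m\<close> takes
  \<open>m\<close> times |S| off the sum on the left and \<open>m\<close> times the edge boundary of
  \<open>S\<close> off the right; expansion of \<open>S\<close> compares the two, and the support
  has strictly shrunk.\<close>

lemma coarea_expansion:
  fixes \<phi> :: "'a \<Rightarrow> real"
  assumes fin: "finite V"
    and expand: "\<And>A. A \<subseteq> V \<Longrightarrow> real (card A) \<le> real (card V) / 2 \<Longrightarrow> c * real (card A) \<le> real (card (edge_boundary V E A))"
    and "\<And>x. x \<in> V \<Longrightarrow> 0 \<le> \<phi> x"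
    and "real (card {x \<in> V. 0 < \<phi> x}) \<le> real (card V) / 2"
  shows "c * (\<Sum>x\<in>V. \<phi> x) \<le> (\<Sum>x\<in>V. \<Sum>y\<in>{y\<in>V. E x y}. max 0 (\<phi> x - \<phi> y))"
  using assms(3,4)
proof (induction "card {x \<in> V. 0 < \<phi> x}" arbitrary: \<phi> rule: less_induct)
  case less
  define S where "S = {x \<in> V. 0 < \<phi> x}"
  have finS: "finite S" "S \<subseteq> V" using fin by (auto simp: S_def)
  show ?case
  proof (cases "S = {}")
    case True
    then have "\<phi> x = 0" if "x \<in> V" for x using less.prems(1)[OF that] that unfolding S_def by (metis (mono_tags, lifting) Collect_empty_eq order_le_less)
    then have "(\<Sum>x\<in>V. \<phi> x) = 0" by simp
    moreover have "0 \<le> (\<Sum>x\<in>V. \<Sum>y\<in>{y\<in>V. E x y}. max 0 (\<phi> x - \<phi> y))" by (intro sum_nonneg) auto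
    ultimately show ?thesis by (simp only: mult_zero_right)
  next
    case False
    define m where "m = Min (\<phi> ` S)"
    have m_le: "m \<le> \<phi> x" if "x \<in> S" for x using finS that by (simp add: m_def)
    have "m \<in> \<phi> ` S" unfolding m_def using finS False by (intro Min_in) auto
    then obtain x0 where x0: "x0 \<in> S" "\<phi> x0 = m" by auto
    then have mpos: "0 < m" by (auto simp: S_def)
    define \<psi> where "\<psi> = (\<lambda>x. if x \<in> S then \<phi> x - m else \<phi> x)"
    have out: "\<phi> x = 0" if "x \<in> V" "x \<notin> S" for x using less.prems(1)[OF that(1)] that by (simp add: S_def)
    have sub: "{x \<in> V. 0 < \<psi> x} \<subset> S"
    proof
      show "{x \<in> V. 0 < \<psi> x} \<subseteq> S"
      proof
        fix x assume "x \<in> {x \<in> V. 0 < \<psi> x}"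
        then show "x \<in> S" using out[of x] by (cases "x \<in> S") (auto simp: \<psi>_def)
      qed
      have "x0 \<notin> {x \<in> V. 0 < \<psi> x}" using x0 by (simp add: \<psi>_def)
      then show "{x \<in> V. 0 < \<psi> x} \<noteq> S" using x0(1) by blast
    qed
    then have card_less: "card {x \<in> V. 0 < \<psi> x} < card S" by (rule psubset_card_mono[OF finS(1)])
    have IH: "c * (\<Sum>x\<in>V. \<psi> x) \<le> (\<Sum>x\<in>V. \<Sum>y\<in>{y\<in>V. E x y}. max 0 (\<psi> x - \<psi> y))"
    proof (rule less.hyps)
      show "card {x \<in> V. 0 < \<psi> x} < card {x \<in> V. 0 < \<phi> x}" using card_less by (simp add: S_def)
      show "0 \<le> \<psi> x" if "x \<in> V" for x using m_le[of x] less.prems(1)[OF that] by (simp add: \<psi>_def)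
      show "real (card {x \<in> V. 0 < \<psi> x}) \<le> real (card V) / 2"
        using card_less less.prems(2) by (simp add: S_def)
    qed
    have "(\<Sum>x\<in>V. \<phi> x) = (\<Sum>x\<in>V. \<psi> x + m * of_bool (x \<in> S))"
      by (rule sum.cong) (auto simp: \<psi>_def)
    also have "\<dots> = (\<Sum>x\<in>V. \<psi> x) + m * real (card S)"
      using finS fin by (simp add: sum.distrib sum_distrib_left[symmetric] of_bool_def sum.If_cases Int_absorb1)
    finally have L: "(\<Sum>x\<in>V. \<phi> x) = (\<Sum>x\<in>V. \<psi> x) + m * real (card S)" .
    \<comment> \<open>The shift by \<open>m\<close> cancels for pairs inside \<open>S\<close> and is
      absent for pairs outside. A pair leaving \<open>S\<close> loses exactly \<open>m\<close>, as
      its values are at least \<open>m\<close> and 0. A pair entering \<open>S\<close> contributes 0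
      before and after.\<close>
    have "(\<Sum>x\<in>V. \<Sum>y\<in>{y\<in>V. E x y}. max 0 (\<phi> x - \<phi> y))
        = (\<Sum>x\<in>V. \<Sum>y\<in>{y\<in>V. E x y}. max 0 (\<psi> x - \<psi> y) + m * of_bool (x \<in> S \<and> y \<notin> S))"
    proof (intro sum.cong refl)
      fix x y assume "x \<in> V" "y \<in> {y \<in> V. E x y}"
      then show "max 0 (\<phi> x - \<phi> y) = max 0 (\<psi> x - \<psi> y) + m * of_bool (x \<in> S \<and> y \<notin> S)"
        using out[of x] out[of y] mpos m_le[of x] m_le[of y] by (cases "x \<in> S"; cases "y \<in> S") (simp_all add: \<psi>_def)
    qed
    also have "\<dots> = (\<Sum>x\<in>V. \<Sum>y\<in>{y\<in>V. E x y}. max 0 (\<psi> x - \<psi> y))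
        + m * (\<Sum>x\<in>V. \<Sum>y\<in>{y\<in>V. E x y}. of_bool (x \<in> S \<and> y \<notin> S))"
      by (simp add: sum.distrib sum_distrib_left)
    also have "(\<Sum>x\<in>V. \<Sum>y\<in>{y\<in>V. E x y}. of_bool (x \<in> S \<and> y \<notin> S)) = real (card (edge_boundary V E S))"
    proof -
      have "(\<Sum>x\<in>V. \<Sum>y\<in>{y\<in>V. E x y}. of_bool (x \<in> S \<and> y \<notin> S))
          = (\<Sum>p\<in>(SIGMA x:V. {y\<in>V. E x y}). of_bool (fst p \<in> S \<and> snd p \<notin> S) :: real)"
        using fin by (subst sum.Sigma) (auto simp: case_prod_beta)
      also have "\<dots> = real (card ((SIGMA x:V. {y\<in>V. E x y}) \<inter> {p. fst p \<in> S \<and> snd p \<notin> S}))"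
        using fin by (simp add: of_bool_def sum.If_cases)
      also have "(SIGMA x:V. {y\<in>V. E x y}) \<inter> {p. fst p \<in> S \<and> snd p \<notin> S} = edge_boundary V E S"
        using finS by (auto simp: edge_boundary_def)
      finally show ?thesis .
    qed
    finally have R: "(\<Sum>x\<in>V. \<Sum>y\<in>{y\<in>V. E x y}. max 0 (\<phi> x - \<phi> y))
        = (\<Sum>x\<in>V. \<Sum>y\<in>{y\<in>V. E x y}. max 0 (\<psi> x - \<psi> y)) + m * real (card (edge_boundary V E S))" .
    have "c * real (card S) \<le> real (card (edge_boundary V E S))"
      using less.prems(2) finS by (intro expand) (auto simp: S_def)
    then have "m * (c * real (card S)) \<le> m * real (card (edge_boundary V E S))"
      using mpos by simp
    then show ?thesis using IH by (simp add: L R algebra_simps)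
  qed
qed

text \<open>The witness is the least value of \<open>f\<close> that is exceeded on at most half of
  the points. If more than half lay strictly below it, the largest value among those would also be
  exceeded on at most half, contradicting minimality.\<close>

lemma median_exists:
  fixes f :: "'a \<Rightarrow> real"
  assumes "finite V" "V \<noteq> {}"
  obtains m where "real (card {x \<in> V. m < f x}) \<le> real (card V) / 2"
    and "real (card {x \<in> V. f x < m}) \<le> real (card V) / 2"
proof -
  have mx: "\<exists>z\<in>W. \<forall>y\<in>W. f y \<le> f z" if "finite W" "W \<noteq> {}" for W
  proof -
    have "Max (f ` W) \<in> f ` W" using that by (intro Max_in) auto
    then obtain z where z: "z \<in> W" "Max (f ` W) = f z" by auto
    have "f y \<le> f z" if "y \<in> W" for y unfolding z(2)[symmetric] using \<open>finite W\<close> that by simp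
    with z(1) show ?thesis by blast
  qed
  define P where "P = {x \<in> V. real (card {y \<in> V. f x < f y}) \<le> real (card V) / 2}"
  have fin: "finite P" "finite (f ` P)" using assms by (auto simp: P_def)
  obtain z where z: "z \<in> V" "\<And>y. y \<in> V \<Longrightarrow> f y \<le> f z"
    using mx[OF assms] by blast
  then have e: "{y \<in> V. f z < f y} = {}" by force
  have "z \<in> P" unfolding P_def using z(1) by (simp add: e del: Collect_empty_eq)
  then have "P \<noteq> {}" by auto
  define m where "m = Min (f ` P)"
  have "m \<in> f ` P" unfolding m_def using fin \<open>P \<noteq> {}\<close> by (intro Min_in) auto
  then have up: "real (card {x \<in> V. m < f x}) \<le> real (card V) / 2" by (auto simp: P_def)
  have "real (card {x \<in> V. f x < m}) \<le> real (card V) / 2"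
  proof (rule ccontr)
    assume neg: "\<not> ?thesis"
    define L where "L = {x \<in> V. f x < m}"
    have "real (card V) / 2 < real (card L)" using neg unfolding L_def by linarith
    then have L: "finite L" "L \<noteq> {}" using assms by (auto simp: L_def[symmetric] card_gt_0_iff intro: card_ge_0_finite)
    then obtain x where x: "x \<in> L" "\<And>y. y \<in> L \<Longrightarrow> f y \<le> f x"
      using mx[OF L] by blast
    have "{y \<in> V. f x < f y} \<subseteq> V - L" using x by (force simp: L_def)
    then have "card {y \<in> V. f x < f y} \<le> card (V - L)" using assms by (intro card_mono) auto
    also have "card (V - L) = card V - card L" using L by (intro card_Diff_subset) (auto simp: L_def)
    finally have "real (card {y \<in> V. f x < f y}) \<le> real (card V) / 2"
      using neg unfolding L_def by linarith
    then have "x \<in> P" using x by (simp add: P_def L_def)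
    then have "m \<le> f x" using fin by (simp add: m_def)
    then show False using x by (simp add: L_def)
  qed
  with up show thesis by (rule that)
qed

text \<open>The operator 1 - L/(2D) with L the graph Laplacian. When degrees are at most D, the walk
  stays put with probability at least 1/2, so its spectrum has no part near -1 and iteration damps
  everything but constants. The codomain is a general real vector space in order to serve real and
  complex functions alike.\<close>

definition lazy_step :: "'a set \<Rightarrow> ('a \<Rightarrow> 'a \<Rightarrow> bool) \<Rightarrow> real \<Rightarrow> ('a \<Rightarrow> 'b) \<Rightarrow> 'a \<Rightarrow> 'b :: real_vector" where
  "lazy_step V E D f x = f x - (1 / (2 * D)) *\<^sub>R (\<Sum>y\<in>{y\<in>V. E x y}. f x - f y)"

section \<open>From expansion of a single finite graph to contraction of its lazy random
  walk\<close>

context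
  fixes V :: "'a set" and E :: "'a \<Rightarrow> 'a \<Rightarrow> bool" and D c :: real
  assumes fin: "finite V" and sym: "\<And>x y. E x y \<Longrightarrow> E y x"
    and deg: "\<And>x. x \<in> V \<Longrightarrow> real (card {y \<in> V. E x y}) \<le> D" and D: "1 \<le> D"
    and c: "0 < c" "c \<le> 1"
    and expand: "\<And>A. A \<subseteq> V \<Longrightarrow> real (card A) \<le> real (card V) / 2 \<Longrightarrow> c * real (card A) \<le> real (card (edge_boundary V E A))"
begin

lemma edge_sum_swap: "(\<Sum>x\<in>V. \<Sum>y\<in>{y\<in>V. E x y}. h x y) = (\<Sum>x\<in>V. \<Sum>y\<in>{y\<in>V. E x y}. h y x)"
proof -
  have "(\<Sum>x\<in>V. \<Sum>y\<in>{y\<in>V. E x y}. h x y) = (\<Sum>y\<in>V. \<Sum>x\<in>{x\<in>V. E x y}. h x y)"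
    by (rule sum.swap_restrict[OF fin fin])
  also have "\<dots> = (\<Sum>x\<in>V. \<Sum>y\<in>{y\<in>V. E x y}. h y x)"
    by (intro sum.cong refl) (auto intro: sym)
  finally show ?thesis .
qed

lemma edge_sum_le_degree:
  assumes "\<And>x. x \<in> V \<Longrightarrow> 0 \<le> (h x :: real)"
  shows "(\<Sum>x\<in>V. \<Sum>y\<in>{y\<in>V. E x y}. h x) \<le> D * (\<Sum>x\<in>V. h x)"
  unfolding sum_distrib_left by (intro sum_mono) (auto intro!: mult_right_mono deg assms)

text \<open>Cheeger's argument: the co-area bound is applied to the square of \<open>g\<close>, and
  the difference of squares factors as (g x - g y)(g x + g y). A weighted arithmetic-geometric mean
  inequality separates the factors; the second is controlled by the degree bound and absorbed on the
  left.\<close>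

lemma dirichlet_ge_half_support:
  fixes g :: "'a \<Rightarrow> real"
  assumes nonneg: "\<And>x. x \<in> V \<Longrightarrow> 0 \<le> g x"
    and supp: "real (card {x \<in> V. 0 < g x}) \<le> real (card V) / 2"
  shows "c\<^sup>2 / (4 * D) * (\<Sum>x\<in>V. (g x)\<^sup>2) \<le> (\<Sum>x\<in>V. \<Sum>y\<in>{y\<in>V. E x y}. (g x - g y)\<^sup>2)"
proof -
  let ?N = "\<Sum>x\<in>V. (g x)\<^sup>2" and ?S = "\<Sum>x\<in>V. \<Sum>y\<in>{y\<in>V. E x y}. (g x - g y)\<^sup>2"
  have "{x \<in> V. 0 < (g x)\<^sup>2} = {x \<in> V. 0 < g x}" using nonneg by force
  then have "c * ?N \<le> (\<Sum>x\<in>V. \<Sum>y\<in>{y\<in>V. E x y}. max 0 ((g x)\<^sup>2 - (g y)\<^sup>2))"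
    using supp by (intro coarea_expansion[OF fin expand]) auto
  also have "\<dots> \<le> (\<Sum>x\<in>V. \<Sum>y\<in>{y\<in>V. E x y}. 2 * D / c * (g x - g y)\<^sup>2 + c / (8 * D) * (2 * ((g x)\<^sup>2 + (g y)\<^sup>2)))"
  proof (intro sum_mono)
    fix x y assume "x \<in> V" "y \<in> {y \<in> V. E x y}"
    then have g: "0 \<le> g x" "0 \<le> g y" using nonneg by auto
    \<comment> \<open>The weight is chosen so that, after summing with degrees at most
      \<open>D\<close>, the terms without differences amount to exactly \<open>c / 2\<close> times
      the sum of squares, half of the left-hand side.\<close>
    define u where "u = 4 * D / c"
    have u: "0 < u" using c D by (simp add: u_def)
    have "0 \<le> (u * (g x - g y) - (g x + g y))\<^sup>2" by simp
    then have "2 * u * ((g x)\<^sup>2 - (g y)\<^sup>2) \<le> u\<^sup>2 * (g x - g y)\<^sup>2 + (g x + g y)\<^sup>2"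
      by (simp add: power2_eq_square algebra_simps)
    then have "(g x)\<^sup>2 - (g y)\<^sup>2 \<le> u / 2 * (g x - g y)\<^sup>2 + 1 / (2 * u) * (g x + g y)\<^sup>2"
      using u by (simp add: field_simps power2_eq_square)
    moreover have "1 / (2 * u) * (g x + g y)\<^sup>2 \<le> 1 / (2 * u) * (2 * ((g x)\<^sup>2 + (g y)\<^sup>2))"
      using u sum_squares_bound[of "g x" "g y"] by (intro mult_left_mono) (simp_all add: power2_sum)
    moreover have "u / 2 = 2 * D / c" "1 / (2 * u) = c / (8 * D)" using c D by (simp_all add: u_def)
    ultimately have "(g x)\<^sup>2 - (g y)\<^sup>2 \<le> 2 * D / c * (g x - g y)\<^sup>2 + c / (8 * D) * (2 * ((g x)\<^sup>2 + (g y)\<^sup>2))"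
      by simp
    moreover have "0 \<le> 2 * D / c * (g x - g y)\<^sup>2 + c / (8 * D) * (2 * ((g x)\<^sup>2 + (g y)\<^sup>2))"
      using c D by simp
    ultimately show "max 0 ((g x)\<^sup>2 - (g y)\<^sup>2) \<le> 2 * D / c * (g x - g y)\<^sup>2 + c / (8 * D) * (2 * ((g x)\<^sup>2 + (g y)\<^sup>2))"
      by simp
  qed
  also have "\<dots> = 2 * D / c * ?S + c / (4 * D) * ((\<Sum>x\<in>V. \<Sum>y\<in>{y\<in>V. E x y}. (g x)\<^sup>2) + (\<Sum>x\<in>V. \<Sum>y\<in>{y\<in>V. E x y}. (g y)\<^sup>2))"
    by (simp add: sum.distrib sum_distrib_left algebra_simps)
  also have "(\<Sum>x\<in>V. \<Sum>y\<in>{y\<in>V. E x y}. (g y)\<^sup>2) = (\<Sum>x\<in>V. \<Sum>y\<in>{y\<in>V. E x y}. (g x)\<^sup>2)"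
    by (rule edge_sum_swap)
  also have "2 * D / c * ?S + c / (4 * D) * ((\<Sum>x\<in>V. \<Sum>y\<in>{y\<in>V. E x y}. (g x)\<^sup>2) + (\<Sum>x\<in>V. \<Sum>y\<in>{y\<in>V. E x y}. (g x)\<^sup>2))
      \<le> 2 * D / c * ?S + c / (4 * D) * (D * ?N + D * ?N)"
    using c D by (intro add_mono mult_left_mono edge_sum_le_degree) auto
  also have "\<dots> = 2 * D / c * ?S + c / 2 * ?N" using D by (simp add: field_simps)
  finally have "c / 2 * ?N \<le> 2 * D / c * ?S" by linarith
  then have "c / (2 * D) * (c / 2 * ?N) \<le> c / (2 * D) * (2 * D / c * ?S)"
    using c D by (intro mult_left_mono) auto
  also have "c / (2 * D) * (2 * D / c * ?S) = ?S" using c D by simp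
  finally show ?thesis by (simp add: power2_eq_square mult_ac)
qed

text \<open>The positive and negative parts of \<open>f - m\<close>, with \<open>m\<close> a median,
  each live on at most half of the vertices, so the previous bound applies to both. Since
  \<open>f\<close> has mean zero, subtracting \<open>m\<close> only adds |V| times the square of
  \<open>m\<close> to the sum of squares, and it leaves differences unchanged.\<close>

lemma poincare_inequality:
  fixes f :: "'a \<Rightarrow> real"
  assumes mean: "(\<Sum>x\<in>V. f x) = 0"
  shows "c\<^sup>2 / (4 * D) * (\<Sum>x\<in>V. (f x)\<^sup>2) \<le> (\<Sum>x\<in>V. \<Sum>y\<in>{y\<in>V. E x y}. (f x - f y)\<^sup>2)"
proof (cases "V = {}")
  case False
  obtain m where m: "real (card {x \<in> V. m < f x}) \<le> real (card V) / 2"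
      "real (card {x \<in> V. f x < m}) \<le> real (card V) / 2"
    by (rule median_exists[OF fin False])
  define g h where "g = (\<lambda>x. max 0 (f x - m))" and "h = (\<lambda>x. max 0 (m - f x))"
  have "c\<^sup>2 / (4 * D) * (\<Sum>x\<in>V. (f x)\<^sup>2) \<le> c\<^sup>2 / (4 * D) * ((\<Sum>x\<in>V. (f x)\<^sup>2) + real (card V) * m\<^sup>2)"
    using D by (intro mult_left_mono) auto
  also have "(\<Sum>x\<in>V. (f x)\<^sup>2) + real (card V) * m\<^sup>2 = (\<Sum>x\<in>V. (f x - m)\<^sup>2)"
    using mean by (simp add: power2_diff sum.distrib sum_subtractf sum_distrib_left[symmetric] sum_distrib_right[symmetric])
  also have "\<dots> = (\<Sum>x\<in>V. (g x)\<^sup>2) + (\<Sum>x\<in>V. (h x)\<^sup>2)"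
    unfolding sum.distrib[symmetric] by (intro sum.cong refl) (auto simp: g_def h_def max_def power2_commute)
  also have "c\<^sup>2 / (4 * D) * ((\<Sum>x\<in>V. (g x)\<^sup>2) + (\<Sum>x\<in>V. (h x)\<^sup>2))
      \<le> (\<Sum>x\<in>V. \<Sum>y\<in>{y\<in>V. E x y}. (g x - g y)\<^sup>2) + (\<Sum>x\<in>V. \<Sum>y\<in>{y\<in>V. E x y}. (h x - h y)\<^sup>2)"
    unfolding distrib_left using m
    by (intro add_mono dirichlet_ge_half_support) (auto simp: g_def h_def less_max_iff_disj)
  also have "\<dots> \<le> (\<Sum>x\<in>V. \<Sum>y\<in>{y\<in>V. E x y}. (f x - f y)\<^sup>2)"
    unfolding sum.distrib[symmetric]
  proof (intro sum_mono)
    \<comment> \<open>If \<open>f - m\<close> keeps its sign on the pair, one of the two differences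
      vanishes and the other equals that of \<open>f\<close> up to sign. If the sign changes, the
      cross term in the square of the difference is favourable.\<close>
    fix x y
    have *: "(a - b)\<^sup>2 \<ge> a\<^sup>2 + b\<^sup>2" if "a * b \<le> 0" for a b :: real
      using that by (simp add: power2_diff)
    show "(g x - g y)\<^sup>2 + (h x - h y)\<^sup>2 \<le> (f x - f y)\<^sup>2"
      using *[of "f x - m" "f y - m"]
      by (auto simp: g_def h_def max_def power2_commute mult_le_0_iff)
  qed
  finally show ?thesis .
qed simp

lemma sum_lazy_step: "(\<Sum>x\<in>V. lazy_step V E D f x) = (\<Sum>x\<in>V. f x)"
proof -
  have "(\<Sum>x\<in>V. \<Sum>y\<in>{y\<in>V. E x y}. f x - f y) = (\<Sum>x\<in>V. \<Sum>y\<in>{y\<in>V. E x y}. f x) - (\<Sum>x\<in>V. \<Sum>y\<in>{y\<in>V. E x y}. f y)"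
    by (simp only: sum_subtractf)
  then have "(\<Sum>x\<in>V. \<Sum>y\<in>{y\<in>V. E x y}. f x - f y) = 0"
    using edge_sum_swap[of "\<lambda>x y. f x"] by simp
  then show ?thesis
    by (simp add: lazy_step_def sum_subtractf scaleR_sum_right[symmetric])
qed

text \<open>With S the Dirichlet sum over ordered pairs and N the sum of squares, expanding the
  square of f - Lf/(2D) needs only that the inner product of f and Lf is S/2 and that the squared
  norm of Lf is at most D S. This gives N - S/(4D), and the Poincare inequality bounds S from
  below.\<close>

lemma lazy_step_contract_real:
  fixes f :: "'a \<Rightarrow> real"
  assumes "(\<Sum>x\<in>V. f x) = 0"
  shows "(\<Sum>x\<in>V. (lazy_step V E D f x)\<^sup>2) \<le> (1 - c\<^sup>2 / (16 * D\<^sup>2)) * (\<Sum>x\<in>V. (f x)\<^sup>2)"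
proof -
  define L where "L = (\<lambda>x. \<Sum>y\<in>{y\<in>V. E x y}. f x - f y)"
  let ?N = "\<Sum>x\<in>V. (f x)\<^sup>2" and ?S = "\<Sum>x\<in>V. \<Sum>y\<in>{y\<in>V. E x y}. (f x - f y)\<^sup>2"
  have "2 * (\<Sum>x\<in>V. f x * L x) = (\<Sum>x\<in>V. \<Sum>y\<in>{y\<in>V. E x y}. f x * (f x - f y)) + (\<Sum>x\<in>V. \<Sum>y\<in>{y\<in>V. E x y}. f y * (f y - f x))"
    using edge_sum_swap[of "\<lambda>x y. f x * (f x - f y)"] by (simp add: L_def sum_distrib_left)
  also have "\<dots> = ?S"
    unfolding sum.distrib[symmetric] by (intro sum.cong refl) (simp add: power2_eq_square algebra_simps)
  finally have fL: "(\<Sum>x\<in>V. f x * L x) = ?S / 2" by simp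
  have LL: "(\<Sum>x\<in>V. (L x)\<^sup>2) \<le> D * ?S"
  proof (subst sum_distrib_left, rule sum_mono)
    fix x assume x: "x \<in> V"
    have "(L x)\<^sup>2 \<le> real (card {y\<in>V. E x y}) * (\<Sum>y\<in>{y\<in>V. E x y}. (f x - f y)\<^sup>2)"
      using Cauchy_Schwarz_ineq_sum[of "\<lambda>_. 1" "\<lambda>y. f x - f y" "{y\<in>V. E x y}"] by (simp add: L_def)
    also have "\<dots> \<le> D * (\<Sum>y\<in>{y\<in>V. E x y}. (f x - f y)\<^sup>2)"
      by (intro mult_right_mono deg x sum_nonneg) auto
    finally show "(L x)\<^sup>2 \<le> D * (\<Sum>y\<in>{y\<in>V. E x y}. (f x - f y)\<^sup>2)" .
  qed
  have "(\<Sum>x\<in>V. (lazy_step V E D f x)\<^sup>2) = (\<Sum>x\<in>V. (f x)\<^sup>2 - 1 / D * (f x * L x) + 1 / (4 * D\<^sup>2) * (L x)\<^sup>2)"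
    using D by (intro sum.cong refl) (simp add: lazy_step_def L_def power2_diff power_divide power_mult_distrib)
  also have "\<dots> = ?N - 1 / D * (?S / 2) + 1 / (4 * D\<^sup>2) * (\<Sum>x\<in>V. (L x)\<^sup>2)"
    by (simp only: sum.distrib sum_subtractf sum_distrib_left[symmetric] fL)
  also have "\<dots> \<le> ?N - 1 / D * (?S / 2) + 1 / (4 * D\<^sup>2) * (D * ?S)"
    by (intro add_left_mono mult_left_mono LL) auto
  also have "\<dots> = ?N - 1 / (4 * D) * ?S" using D by (simp add: field_simps power2_eq_square)
  also have "\<dots> \<le> ?N - 1 / (4 * D) * (c\<^sup>2 / (4 * D) * ?N)"
    using D by (intro diff_left_mono mult_left_mono poincare_inequality assms) auto
  also have "\<dots> = (1 - c\<^sup>2 / (16 * D\<^sup>2)) * ?N" by (simp add: power2_eq_square algebra_simps)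
  finally show ?thesis .
qed

lemma lazy_step_contract:
  fixes f :: "'a \<Rightarrow> complex"
  assumes "(\<Sum>x\<in>V. f x) = 0"
  shows "(\<Sum>x\<in>V. (cmod (lazy_step V E D f x))\<^sup>2) \<le> (1 - c\<^sup>2 / (16 * D\<^sup>2)) * (\<Sum>x\<in>V. (cmod (f x))\<^sup>2)"
proof -
  have re: "Re (lazy_step V E D f x) = lazy_step V E D (\<lambda>x. Re (f x)) x" and im: "Im (lazy_step V E D f x) = lazy_step V E D (\<lambda>x. Im (f x)) x" for x
    by (simp_all add: lazy_step_def Re_sum Im_sum)
  have "(\<Sum>x\<in>V. Re (f x)) = 0" "(\<Sum>x\<in>V. Im (f x)) = 0"
    using assms by (simp_all add: Re_sum[symmetric] Im_sum[symmetric])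
  then show ?thesis
    using lazy_step_contract_real[of "\<lambda>x. Re (f x)"] lazy_step_contract_real[of "\<lambda>x. Im (f x)"]
    by (simp add: cmod_power2 re im sum.distrib distrib_left)
qed

end


subsection \<open>The uniform Roe algebra\<close>

lemma
  assumes "partial_translation V d D f" "\<xi> \<in> l2 V"
  shows vop_l2: "vop V D f \<xi> \<in> l2 V" and l2norm_vop_le: "l2norm V (vop V D f \<xi>) \<le> l2norm V \<xi>"
proof -
  have D: "D \<subseteq> Xc V" "f ` D \<subseteq> Xc V" using assms(1) by (auto simp: partial_translation_def)
  have "L2_set (\<lambda>z. cmod (vop V D f \<xi> z)) F \<le> l2norm V \<xi>" if F: "finite F" "F \<subseteq> Xc V" for F
  proof -
    let ?G = "inv_into D f ` (F \<inter> f ` D)"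
    have inj: "inj_on (inv_into D f) (F \<inter> f ` D)"
      by (rule inj_on_subset[OF inj_on_inv_into[OF subset_refl]]) auto
    have "(\<Sum>z\<in>F. (cmod (vop V D f \<xi> z))\<^sup>2) = (\<Sum>z\<in>F \<inter> f ` D. (cmod (\<xi> (inv_into D f z)))\<^sup>2)"
      using F assms(2) by (intro sum.mono_neutral_cong_right) (auto simp: vop_def)
    also have "\<dots> = (\<Sum>z\<in>?G. (cmod (\<xi> z))\<^sup>2)" by (simp add: sum.reindex[OF inj])
    also have "\<dots> \<le> (l2norm V \<xi>)\<^sup>2"
    proof (intro sum_le_l2norm_sq assms)
      show "?G \<subseteq> Xc V"
      proof (rule image_subsetI)
        fix y assume "y \<in> F \<inter> f ` D"
        then have "inv_into D f y \<in> D" by (intro inv_into_into) simp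
        then show "inv_into D f y \<in> Xc V" using D(1) by (rule subsetD[rotated])
      qed
    qed (use F in simp)
    finally show ?thesis by (simp add: L2_set_def real_le_lsqrt sum_nonneg)
  qed
  moreover have "vop V D f \<xi> z = 0" if "z \<notin> Xc V" for z using D that by (auto simp: vop_def)
  ultimately show "vop V D f \<xi> \<in> l2 V" "l2norm V (vop V D f \<xi>) \<le> l2norm V \<xi>"
    using l2I[of V "vop V D f \<xi>"] l2norm_leI[of V "vop V D f \<xi>"] by metis+
qed

lemma bop_vop:
  assumes "partial_translation V d D f" shows "bop V (vop V D f)"
  by (rule bopI[where C = 1])
     (use l2norm_vop_le[OF assms] vop_l2[OF assms] in \<open>auto simp: vop_def l2_lincomb\<close>)

lemma cstar_subalg_bop: "cstar_subalg V {T. bop V T}"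
  by (auto simp: cstar_subalg_def bop_oadd bop_comp bop_oscale bop_adj)

text \<open>Every closure condition passes to intersections. That \<open>Cu V d\<close> consists of
  bounded operators requires a member of the intersected family: the algebra of all bounded
  operators is one.\<close>

lemma Cu_cstar_subalg: "cstar_subalg V (Cu V d)"
proof -
  have 1: "Cu V d \<subseteq> {T. bop V T}"
    unfolding Cu_def using cstar_subalg_bop bop_vop by (intro Inter_lower) blast
  have 2: "T \<in> Cu V d"
    if T: "bop V T" "\<forall>e>0. \<exists>a\<in>Cu V d. opnorm V (odiff T a) < e" for T
    unfolding Cu_def
  proof safe
    fix A assume A: "cstar_subalg V A" "\<forall>D f. partial_translation V d D f \<longrightarrow> vop V D f \<in> A"
    then have "Cu V d \<subseteq> A" by (auto simp: Cu_def)
    then have "\<forall>e>0. \<exists>a\<in>A. opnorm V (odiff T a) < e" using T(2) by blast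
    then show "T \<in> A" using A(1) T(1) by (simp add: cstar_subalg_def)
  qed
  have mem: "T \<in> Cu V d \<longleftrightarrow>
      (\<forall>A. cstar_subalg V A \<longrightarrow> (\<forall>D f. partial_translation V d D f \<longrightarrow> vop V D f \<in> A) \<longrightarrow> T \<in> A)" for T
    by (auto simp: Cu_def)
  have 3: "oadd a b \<in> Cu V d" "a \<circ> b \<in> Cu V d" if "a \<in> Cu V d" "b \<in> Cu V d" for a b
    using that unfolding mem by (simp_all add: cstar_subalg_def)
  have 4: "oscale c a \<in> Cu V d" "adj V a \<in> Cu V d" if "a \<in> Cu V d" for a c
    using that unfolding mem by (simp_all add: cstar_subalg_def)
  show ?thesis unfolding cstar_subalg_def
  proof (intro conjI ballI allI impI)
    fix T assume "bop V T \<and> (\<forall>e>0. \<exists>a\<in>Cu V d. opnorm V (odiff T a) < e)"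
    then show "T \<in> Cu V d" by (elim conjE) (rule 2)
  qed (use 1 3 4 in simp_all)
qed

lemma Cu_bop: "a \<in> Cu V d \<Longrightarrow> bop V a"
  using Cu_cstar_subalg[of V d] unfolding cstar_subalg_def by blast

lemma Cu_oadd: "a \<in> Cu V d \<Longrightarrow> b \<in> Cu V d \<Longrightarrow> oadd a b \<in> Cu V d"
  using Cu_cstar_subalg[of V d] unfolding cstar_subalg_def by blast

lemma Cu_comp: "a \<in> Cu V d \<Longrightarrow> b \<in> Cu V d \<Longrightarrow> a \<circ> b \<in> Cu V d"
  using Cu_cstar_subalg[of V d] unfolding cstar_subalg_def by blast

lemma Cu_oscale: "a \<in> Cu V d \<Longrightarrow> oscale c a \<in> Cu V d"
  using Cu_cstar_subalg[of V d] unfolding cstar_subalg_def by blast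

lemma Cu_closed: "bop V T \<Longrightarrow> (\<And>e. 0 < e \<Longrightarrow> \<exists>a\<in>Cu V d. opnorm V (odiff T a) < e) \<Longrightarrow> T \<in> Cu V d"
  using Cu_cstar_subalg[of V d] unfolding cstar_subalg_def by blast

lemma Cu_vop: "partial_translation V d D f \<Longrightarrow> vop V D f \<in> Cu V d"
  by (auto simp: Cu_def)

lemma Cu_sum:
  assumes "finite I" "\<And>i. i \<in> I \<Longrightarrow> T i \<in> Cu V d"
  shows "(\<lambda>\<xi> z. \<Sum>i\<in>I. T i \<xi> z) \<in> Cu V d"
  using assms
proof (induction rule: finite_induct)
  case empty
  \<comment> \<open>The empty partial translation supplies the zero operator for the empty
    sum.\<close>
  have "partial_translation V d {} id" by (simp add: partial_translation_def)
  moreover have "vop V {} id = (\<lambda>\<xi> z. 0)" by (simp add: vop_def)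
  ultimately show ?case using Cu_vop by fastforce
next
  case (insert i I)
  then show ?case using Cu_oadd[of "T i" V d "\<lambda>\<xi> z. \<Sum>i\<in>I. T i \<xi> z"] by (simp add: oadd_def)
qed

section \<open>Multiplication operators in the uniform Roe algebra\<close>

definition mulop :: "(nat \<Rightarrow> 'a set) \<Rightarrow> (nat \<times> 'a \<Rightarrow> complex) \<Rightarrow> 'a op" where
  "mulop V b = (\<lambda>\<xi> z. if \<xi> \<in> l2 V then b z * \<xi> z else 0)"

lemma mulop_dominated:
  assumes "\<And>z. z \<in> Xc V \<Longrightarrow> cmod (b z) \<le> B" "0 \<le> B" "\<xi> \<in> l2 V"
  shows "cmod (mulop V b \<xi> z) \<le> B * cmod (\<xi> z)"
  using assms l2D_outside[OF assms(3), of z]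
  by (cases "z \<in> Xc V") (auto simp: mulop_def norm_mult mult_right_mono)

lemma bop_mulop:
  assumes "\<And>z. z \<in> Xc V \<Longrightarrow> cmod (b z) \<le> B" "0 \<le> B"
  shows "bop V (mulop V b)"
proof (rule bopI[where C = B])
  show "mulop V b \<xi> \<in> l2 V" "l2norm V (mulop V b \<xi>) \<le> B * l2norm V \<xi>" if "\<xi> \<in> l2 V" for \<xi>
    using l2_dominated[OF that mulop_dominated[OF assms that] assms(2)]
      l2norm_dominated[OF that mulop_dominated[OF assms that] assms(2)] by simp_all
qed (auto simp: mulop_def l2_lincomb distrib_left mult.left_commute)

context
  fixes V :: "nat \<Rightarrow> 'a set" and d :: "nat \<times> 'a \<Rightarrow> nat \<times> 'a \<Rightarrow> real"
  assumes d_self: "\<And>x. x \<in> Xc V \<Longrightarrow> d x x = 0"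
begin

lemma Cu_indicator:
  assumes "A \<subseteq> Xc V" shows "mulop V (\<lambda>z. of_bool (z \<in> A)) \<in> Cu V d"
proof -
  have "partial_translation V d A id"
    using assms d_self by (auto simp: partial_translation_def intro!: exI[of _ 0])
  moreover have "vop V A id = mulop V (\<lambda>z. of_bool (z \<in> A))"
    by (auto simp: vop_def mulop_def fun_eq_iff inv_into_f_f[of id A, simplified])
  ultimately show ?thesis using Cu_vop by metis
qed

lemma Cu_oid: "oid V \<in> Cu V d"
proof -
  have "oid V = mulop V (\<lambda>z. of_bool (z \<in> Xc V))"
    by (auto simp: oid_def mulop_def fun_eq_iff l2D_outside)
  then show ?thesis using Cu_indicator[of "Xc V"] by simp
qed

lemma Cu_mulop_finite_range:
  assumes "finite (b ` Xc V)" shows "mulop V b \<in> Cu V d"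
proof -
  have "mulop V b = (\<lambda>\<xi> z. \<Sum>v\<in>b ` Xc V. oscale v (mulop V (\<lambda>z. of_bool (z \<in> {z\<in>Xc V. b z = v}))) \<xi> z)"
  proof (intro ext)
    fix \<xi> z
    show "mulop V b \<xi> z = (\<Sum>v\<in>b ` Xc V. oscale v (mulop V (\<lambda>z. of_bool (z \<in> {z\<in>Xc V. b z = v}))) \<xi> z)"
    proof (cases "\<xi> \<in> l2 V \<and> z \<in> Xc V")
      case True
      have "(\<Sum>v\<in>b ` Xc V. oscale v (mulop V (\<lambda>z. of_bool (z \<in> {z\<in>Xc V. b z = v}))) \<xi> z)
          = (\<Sum>v\<in>b ` Xc V. if v = b z then v * \<xi> z else 0)"
        using True by (intro sum.cong) (auto simp: oscale_def mulop_def)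
      then show ?thesis using True assms by (simp add: mulop_def)
    next
      case False
      then show ?thesis by (auto simp: oscale_def mulop_def l2D_outside)
    qed
  qed
  moreover have "\<dots> \<in> Cu V d"
    using assms by (intro Cu_sum Cu_oscale Cu_indicator) auto
  ultimately show ?thesis by simp
qed

text \<open>Rounding the real and imaginary parts of \<open>b\<close> down to multiples of 1/m moves
  each by at most 1/m and, \<open>b\<close> being bounded, leaves finitely many values. Norm
  closedness then covers \<open>b\<close> itself.\<close>

lemma Cu_mulop:
  assumes B: "\<And>z. z \<in> Xc V \<Longrightarrow> cmod (b z) \<le> B" shows "mulop V b \<in> Cu V d"
proof (rule Cu_closed)
  have B': "cmod (b z) \<le> max B 0" if "z \<in> Xc V" for z using B[OF that] by simp
  show "bop V (mulop V b)" by (rule bop_mulop[OF B']) auto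
  fix e :: real assume "0 < e"
  define m where "m = nat \<lceil>2 / e\<rceil> + 1"
  have m: "0 < real m" "2 / real m < e"
  proof -
    have "2 / e < real m" unfolding m_def by linarith
    moreover show "0 < real m" by (simp add: m_def)
    ultimately show "2 / real m < e" using \<open>0 < e\<close> by (simp add: field_simps)
  qed
  define g where "g = (\<lambda>z. Complex (\<lfloor>real m * Re (b z)\<rfloor> / real m) (\<lfloor>real m * Im (b z)\<rfloor> / real m))"
  define K where "K = \<lceil>real m * max B 0\<rceil> + 1"
  have fl: "\<lfloor>real m * t\<rfloor> \<in> {-K..K}" if "\<bar>t\<bar> \<le> max B 0" for t
  proof -
    have "\<bar>real m * t\<bar> \<le> real m * max B 0" using that m by (simp add: abs_mult)
    then show ?thesis unfolding K_def by (simp add: abs_le_iff) linarith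
  qed
  have "g ` Xc V \<subseteq> (\<lambda>(i, j). Complex (of_int i / real m) (of_int j / real m)) ` ({-K..K} \<times> {-K..K})"
  proof safe
    fix n x assume "(n, x) \<in> Xc V"
    then have "cmod (b (n, x)) \<le> max B 0" by (rule B')
    then have "\<bar>Re (b (n, x))\<bar> \<le> max B 0" "\<bar>Im (b (n, x))\<bar> \<le> max B 0"
      using abs_Re_le_cmod abs_Im_le_cmod order_trans by blast+
    from fl[OF this(1)] fl[OF this(2)]
    show "g (n, x) \<in> (\<lambda>(i, j). Complex (of_int i / real m) (of_int j / real m)) ` ({-K..K} \<times> {-K..K})"
      unfolding g_def by (auto intro!: image_eqI[of _ _ "(\<lfloor>real m * Re (b (n, x))\<rfloor>, \<lfloor>real m * Im (b (n, x))\<rfloor>)"])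
  qed
  then have "finite (g ` Xc V)" by (rule finite_subset) auto
  then have gC: "mulop V g \<in> Cu V d" by (rule Cu_mulop_finite_range)
  have close: "cmod (b z - g z) \<le> 2 / real m" for z
  proof -
    have *: "\<bar>t - \<lfloor>real m * t\<rfloor> / real m\<bar> \<le> 1 / real m" for t
    proof -
      have "real m * \<bar>t - \<lfloor>real m * t\<rfloor> / real m\<bar> = \<bar>real m * t - \<lfloor>real m * t\<rfloor>\<bar>"
        using m by (simp add: abs_mult_pos' algebra_simps)
      also have "\<dots> \<le> 1" by linarith
      finally show ?thesis using m by (simp add: field_simps)
    qed
    have "cmod (b z - g z) \<le> \<bar>Re (b z - g z)\<bar> + \<bar>Im (b z - g z)\<bar>" by (rule cmod_le)
    then show ?thesis using *[of "Re (b z)"] *[of "Im (b z)"] by (simp add: g_def)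
  qed
  have "opnorm V (odiff (mulop V b) (mulop V g)) \<le> 2 / real m"
  proof (rule opnorm_leI)
    fix \<xi> assume \<xi>: "\<xi> \<in> l2 V"
    show "l2norm V (odiff (mulop V b) (mulop V g) \<xi>) \<le> 2 / real m * l2norm V \<xi>"
      using close \<xi>
      by (intro l2norm_dominated) (auto simp: odiff_def mulop_def left_diff_distrib[symmetric] norm_mult intro!: mult_right_mono simp del: times_divide_eq_left)
  qed auto
  with m(2) gC show "\<exists>a\<in>Cu V d. opnorm V (odiff (mulop V b) a) < e" by (intro bexI[of _ "mulop V g"]) auto
qed

end


subsection \<open>The ghost projection\<close>

lemma gdist_edge_le:
  assumes "simple_graph V E" "E x y" shows "gdist V E x y \<le> 1"
proof -
  have "walk V E [x, y]" using assms by (auto simp: walk_def simple_graph_def less_Suc_eq)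
  then show ?thesis unfolding gdist_def by (intro Least_le exI[of _ "[x, y]"]) simp
qed

text \<open>An edge from \<open>x\<close> to \<open>y\<close> is labelled \<open>(i, j)\<close> when \<open>y\<close> is the \<open>i\<close>-th neighbour of \<open>x\<close> and
  \<open>x\<close> is the \<open>j\<close>-th neighbour of \<open>y\<close>. The edges with a given label form a partial translation.\<close>
lemma adjacency_Cu:
  assumes fin: "\<And>n. finite (V n)" and graph: "\<And>n. simple_graph (V n) (E n)"
    and deg: "\<And>n x. x \<in> V n \<Longrightarrow> card {y \<in> V n. E n x y} \<le> K"
    and metric: "coarse_union_metric V E d"
  shows "(\<lambda>\<xi> z. if \<xi> \<in> l2 V \<and> z \<in> Xc V then \<Sum>y\<in>{y\<in>V (fst z). E (fst z) (snd z) y}. \<xi> (fst z, y) else 0) \<in> Cu V d"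
proof -
  define N where "N = (\<lambda>z. {y\<in>V (fst z). E (fst z) (snd z) y})"
  have finN: "finite (N z)" for z using fin by (simp add: N_def)
  have "\<forall>z. \<exists>h. bij_betw h {..<card (N z)} (N z)"
    using ex_bij_betw_nat_finite[OF finN] by (simp add: atLeast0LessThan)
  then obtain e where e: "\<And>z. bij_betw (e z) {..<card (N z)} (N z)" by metis
  define f where "f = (\<lambda>i z. (fst z, e z i))"
  define S where "S = (\<lambda>i j. {z \<in> Xc V. i < card (N z) \<and> j < card (N (f i z)) \<and> e (f i z) j = snd z})"
  have eN: "e z i \<in> N z" if "i < card (N z)" for z i using bij_betwE[OF e] that by blast
  have fX: "f i z \<in> Xc V" if "i < card (N z)" for i z
    using eN[OF that] by (simp add: f_def N_def Xc_def)
  have inverse: "f j (f i z) = z" if "z \<in> S i j" for i j z using that by (auto simp: S_def f_def)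
  have inj: "inj_on (f i) (S i j)" for i j using inverse by (intro inj_on_inverseI)
  have trans: "partial_translation V d (S i j) (f i)" for i j
    unfolding partial_translation_def
  proof (intro conjI inj)
    show "S i j \<subseteq> Xc V" by (auto simp: S_def)
    show "f i ` S i j \<subseteq> Xc V" using fX by (auto simp: S_def)
    show "\<exists>R. \<forall>x\<in>S i j. d x (f i x) \<le> R"
    proof (intro exI[of _ 1] ballI)
      fix z assume z: "z \<in> S i j"
      obtain n x where nx: "z = (n, x)" by (cases z)
      have "e z i \<in> N z" using z by (intro eN) (simp add: S_def)
      then have "e z i \<in> V n" "E n x (e z i)" "x \<in> V n" using z by (auto simp: N_def nx S_def Xc_def)
      then have "d (n, x) (n, e z i) = real (gdist (V n) (E n) x (e z i))"
        using metric unfolding coarse_union_metric_def by blast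
      then show "d z (f i z) \<le> 1"
        using gdist_edge_le[of "V n" "E n" x "e z i"] graph \<open>E n x (e z i)\<close> by (simp add: f_def nx)
    qed
  qed
  \<comment> \<open>The inverse of \<open>f i\<close> on \<open>S i j\<close> is \<open>f j\<close>.
    Reading the label backwards turns membership in the image into a condition at \<open>z\<close>
    alone, which makes \<open>vop\<close> explicit.\<close>
  have range: "z \<in> f i ` S i j \<longleftrightarrow> j < card (N z) \<and> i < card (N (f j z)) \<and> e (f j z) i = snd z" if "z \<in> Xc V" for z i j
  proof
    assume "z \<in> f i ` S i j"
    then obtain y where y: "y \<in> S i j" "z = f i y" by auto
    then show "j < card (N z) \<and> i < card (N (f j z)) \<and> e (f j z) i = snd z"
      using inverse[OF y(1)] by (auto simp: S_def) (simp add: f_def)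
  next
    assume h: "j < card (N z) \<and> i < card (N (f j z)) \<and> e (f j z) i = snd z"
    then have "f i (f j z) = z" by (simp add: f_def)
    moreover have "f j z \<in> S i j" using h fX[of j z] \<open>f i (f j z) = z\<close> by (simp add: S_def) (simp add: f_def)
    ultimately show "z \<in> f i ` S i j" by (metis image_eqI)
  qed
  have vop: "vop V (S i j) (f i) \<xi> z = (if j < card (N z) \<and> i < card (N (f j z)) \<and> e (f j z) i = snd z then \<xi> (f j z) else 0)"
    if "\<xi> \<in> l2 V" "z \<in> Xc V" for \<xi> z i j
  proof -
    have "inv_into (S i j) (f i) z = f j z" if z: "z \<in> f i ` S i j"
    proof -
      obtain y where y: "y \<in> S i j" "z = f i y" using z by auto
      then show ?thesis using inj inverse[OF y(1)] by (simp add: inv_into_f_f)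
    qed
    then show ?thesis using that range[OF that(2)] by (simp add: vop_def)
  qed
  have "(\<lambda>\<xi> z. \<Sum>j\<in>{..<K}. \<Sum>i\<in>{..<K}. vop V (S i j) (f i) \<xi> z) \<in> Cu V d"
    by (intro Cu_sum Cu_vop trans finite_lessThan)
  moreover have "(\<Sum>j<K. \<Sum>i<K. vop V (S i j) (f i) \<xi> z)
      = (if \<xi> \<in> l2 V \<and> z \<in> Xc V then \<Sum>y\<in>N z. \<xi> (fst z, y) else 0)" for \<xi> z
  proof (cases "\<xi> \<in> l2 V \<and> z \<in> Xc V")
    case True
    have cN: "card (N y) \<le> K" if "y \<in> Xc V" for y
      using deg[of "snd y" "fst y"] that by (auto simp: N_def Xc_def)
    \<comment> \<open>For a fixed \<open>j\<close>, the edge from the \<open>j\<close>-th neighbour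
      back to \<open>z\<close> has exactly one index \<open>i0\<close> there. Summing over
      \<open>i\<close> therefore counts this neighbour once.\<close>
    have inner: "(\<Sum>i<K. vop V (S i j) (f i) \<xi> z) = (if j < card (N z) then \<xi> (f j z) else 0)" for j
    proof (cases "j < card (N z)")
      case j: True
      have "snd z \<in> N (f j z)"
        using eN[OF j] True graph by (auto simp: N_def f_def simple_graph_def)
      then obtain i0 where i0: "i0 < card (N (f j z))" "e (f j z) i0 = snd z"
        using bij_betw_imp_surj_on[OF e, of "f j z"] by (metis imageE lessThan_iff)
      have uniq: "i < card (N (f j z)) \<and> e (f j z) i = snd z \<longleftrightarrow> i = i0" for i
        using i0 e[of "f j z"] by (auto simp: bij_betw_def inj_on_def)
      have "i0 < K" using i0(1) cN[OF fX[OF j]] by simp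
      then show ?thesis using True j by (simp add: vop uniq)
    qed (use True in \<open>simp add: vop\<close>)
    have "(\<Sum>j<K. \<Sum>i<K. vop V (S i j) (f i) \<xi> z) = (\<Sum>j<card (N z). \<xi> (fst z, e z j))"
      unfolding inner using cN[of z] True
      by (intro sum.mono_neutral_cong_right) (auto simp: f_def)
    also have "\<dots> = (\<Sum>y\<in>N z. \<xi> (fst z, y))" by (rule sum.reindex_bij_betw[OF e])
    finally show ?thesis using True by simp
  next
    case False
    have "vop V (S i j) (f i) \<xi> z = 0" for i j
      using False trans[of i j] by (auto simp: vop_def partial_translation_def)
    then show ?thesis unfolding if_not_P[OF False] by simp
  qed
  ultimately show ?thesis unfolding N_def by simp
qed

text \<open>Estimates uniform over the blocks pass to the direct sum: a finite set of points is
  enlarged to the union of the blocks it meets, which is still finite.\<close>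

lemma
  assumes fin: "\<And>n. finite (V n)" and \<xi>: "\<xi> \<in> l2 V"
    and out: "\<And>z. z \<notin> Xc V \<Longrightarrow> \<eta> z = 0" and C: "0 \<le> C"
    and le: "\<And>n. (\<Sum>x\<in>V n. (cmod (\<eta> (n, x)))\<^sup>2) \<le> C\<^sup>2 * (\<Sum>x\<in>V n. (cmod (\<xi> (n, x)))\<^sup>2)"
  shows l2_blockwise: "\<eta> \<in> l2 V" and l2norm_blockwise: "l2norm V \<eta> \<le> C * l2norm V \<xi>"
proof -
  have "L2_set (\<lambda>z. cmod (\<eta> z)) F \<le> C * l2norm V \<xi>" if F: "finite F" "F \<subseteq> Xc V" for F
  proof -
    define G where "G = (SIGMA n:fst ` F. V n)"
    have G: "finite G" "F \<subseteq> G" "G \<subseteq> Xc V" using F fin by (force simp: G_def Xc_def)+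
    have "(\<Sum>z\<in>F. (cmod (\<eta> z))\<^sup>2) \<le> (\<Sum>z\<in>G. (cmod (\<eta> z))\<^sup>2)" using G by (intro sum_mono2) auto
    also have "\<dots> = (\<Sum>n\<in>fst ` F. \<Sum>x\<in>V n. (cmod (\<eta> (n, x)))\<^sup>2)"
      unfolding G_def using F fin by (subst sum.Sigma) (auto simp: case_prod_beta)
    also have "\<dots> \<le> (\<Sum>n\<in>fst ` F. C\<^sup>2 * (\<Sum>x\<in>V n. (cmod (\<xi> (n, x)))\<^sup>2))" by (intro sum_mono le)
    also have "\<dots> = C\<^sup>2 * (\<Sum>n\<in>fst ` F. \<Sum>x\<in>V n. (cmod (\<xi> (n, x)))\<^sup>2)" by (simp add: sum_distrib_left)
    also have "(\<Sum>n\<in>fst ` F. \<Sum>x\<in>V n. (cmod (\<xi> (n, x)))\<^sup>2) = (\<Sum>z\<in>G. (cmod (\<xi> z))\<^sup>2)"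
      unfolding G_def using F fin by (subst sum.Sigma) (auto simp: case_prod_beta)
    also have "C\<^sup>2 * (\<Sum>z\<in>G. (cmod (\<xi> z))\<^sup>2) \<le> C\<^sup>2 * (l2norm V \<xi>)\<^sup>2"
      using G by (intro mult_left_mono sum_le_l2norm_sq \<xi>) auto
    finally show ?thesis
      using C by (simp add: L2_set_def real_le_lsqrt sum_nonneg power_mult_distrib)
  qed
  then show "\<eta> \<in> l2 V" "l2norm V \<eta> \<le> C * l2norm V \<xi>"
    using out l2I[of V \<eta>] l2norm_leI[of V \<eta>] by metis+
qed

text \<open>The strong sum of all averaging projections; at \<open>z\<close> only the summand of the
  block \<open>fst z\<close> is nonzero. The name refers to its coefficients, which tend to 0 along
  an expander sequence although the operator is not compact.\<close>

definition ghost_proj :: "(nat \<Rightarrow> 'a set) \<Rightarrow> 'a op" where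
  "ghost_proj V = (\<lambda>\<xi> z. avgproj V (fst z) \<xi> z)"

text \<open>Pythagoras for the splitting of a function into its mean and its fluctuation. It gives
  contractivity of \<open>ghost_proj\<close> and the starting bound for the iterated walk.\<close>

lemma sum_cmod_diff_mean:
  fixes f :: "'a \<Rightarrow> complex"
  assumes "finite A" defines "m \<equiv> (\<Sum>x\<in>A. f x) / of_nat (card A)"
  shows "(\<Sum>x\<in>A. (cmod (f x))\<^sup>2) = (\<Sum>x\<in>A. (cmod (f x - m))\<^sup>2) + real (card A) * (cmod m)\<^sup>2"
proof (cases "A = {}")
  case False
  then have s: "(\<Sum>x\<in>A. f x) = of_nat (card A) * m" using assms by simp
  have re: "(\<Sum>x\<in>A. Re (f x)) = card A * Re m" and im: "(\<Sum>x\<in>A. Im (f x)) = card A * Im m"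
    using arg_cong[OF s, of Re] arg_cong[OF s, of Im] by simp_all
  have "(\<Sum>x\<in>A. (cmod (f x - m))\<^sup>2) = (\<Sum>x\<in>A. (cmod (f x))\<^sup>2 + (cmod m)\<^sup>2 - 2 * Re m * Re (f x) - 2 * Im m * Im (f x))"
    by (intro sum.cong refl) (simp add: cmod_power2, simp add: power2_eq_square algebra_simps)
  also have "\<dots> = (\<Sum>x\<in>A. (cmod (f x))\<^sup>2) + card A * (cmod m)\<^sup>2 - 2 * Re m * (card A * Re m) - 2 * Im m * (card A * Im m)"
    by (simp only: sum.distrib sum_subtractf sum_distrib_left[symmetric] re im sum_constant)
  also have "\<dots> = (\<Sum>x\<in>A. (cmod (f x))\<^sup>2) - card A * (cmod m)\<^sup>2"
    by (simp add: cmod_power2, simp add: power2_eq_square algebra_simps)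
  finally show ?thesis by simp
qed simp

lemma ghost_proj_apply:
  "\<xi> \<in> l2 V \<Longrightarrow> x \<in> V n \<Longrightarrow> ghost_proj V \<xi> (n, x) = (\<Sum>y\<in>V n. \<xi> (n, y)) / of_nat (card (V n))"
  by (simp add: ghost_proj_def avgproj_def Xc_def)

lemma ghost_proj_outside: "\<xi> \<notin> l2 V \<or> z \<notin> Xc V \<Longrightarrow> ghost_proj V \<xi> z = 0"
  by (auto simp: ghost_proj_def avgproj_def)

lemma bop_ghost_proj:
  assumes fin: "\<And>n. finite (V n)" shows "bop V (ghost_proj V)"
proof (rule bopI[where C = 1])
  fix \<xi> assume \<xi>: "\<xi> \<in> l2 V"
  have "(\<Sum>x\<in>V n. (cmod (ghost_proj V \<xi> (n, x)))\<^sup>2) \<le> 1\<^sup>2 * (\<Sum>x\<in>V n. (cmod (\<xi> (n, x)))\<^sup>2)" for n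
    using sum_cmod_diff_mean[OF fin, of "\<lambda>x. \<xi> (n, x)" n] by (simp add: ghost_proj_apply[OF \<xi>] sum_nonneg)
  then show "ghost_proj V \<xi> \<in> l2 V" "l2norm V (ghost_proj V \<xi>) \<le> 1 * l2norm V \<xi>"
    by (intro l2_blockwise[OF fin \<xi>, of _ 1] l2norm_blockwise[OF fin \<xi>, of _ 1] ghost_proj_outside; simp)+
qed (auto simp: ghost_proj_def avgproj_def l2_lincomb fun_eq_iff sum.distrib sum_distrib_left add_divide_distrib)

lemma ghost_proj_Cu:
  assumes "expander_seq V E" "coarse_union_metric V E d"
  shows "ghost_proj V \<in> Cu V d"
proof -
  have fin: "\<And>n. finite (V n)" and graph: "\<And>n. simple_graph (V n) (E n)"
    using assms(1) by (auto simp: expander_seq_def)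
  obtain K where K: "\<And>n x. x \<in> V n \<Longrightarrow> card {y \<in> V n. E n x y} \<le> K"
    using assms(1) by (auto simp: expander_seq_def)
  obtain c0 :: real where c0: "0 < c0" "\<And>n A. A \<subseteq> V n \<Longrightarrow> real (card A) \<le> real (card (V n)) / 2 \<Longrightarrow>
      c0 * real (card A) \<le> real (card (edge_boundary (V n) (E n) A))"
    using assms(1) by (auto simp: expander_seq_def)
  \<comment> \<open>Adding 1 makes \<open>D\<close> at least 1 even if all degrees are 0. Capping
    the constant at 1 keeps the contraction factor \<open>r\<close> nonnegative, so that its square
    root can serve as a rate.\<close>
  define D c where "D = real K + 1" and "c = min c0 1"
  have D: "1 \<le> D" "\<And>n x. x \<in> V n \<Longrightarrow> real (card {y \<in> V n. E n x y}) \<le> D"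
    using K by (auto simp: D_def intro: order_trans[of _ "real K"])
  have c: "0 < c" "c \<le> 1" using c0(1) by (auto simp: c_def)
  have expand: "c * real (card A) \<le> real (card (edge_boundary (V n) (E n) A))"
    if "A \<subseteq> V n" "real (card A) \<le> real (card (V n)) / 2" for n A
    using c0(2)[OF that] mult_right_mono[of c c0 "real (card A)"] by (simp add: c_def)
  have sym: "E n x y \<Longrightarrow> E n y x" for n x y using graph by (simp add: simple_graph_def)
  define r where "r = 1 - c\<^sup>2 / (16 * D\<^sup>2)"
  have r: "0 \<le> r" "r < 1"
  proof -
    have "c\<^sup>2 \<le> 1" "1 \<le> D\<^sup>2" using c D by (simp_all add: power_le_one)
    then have "c\<^sup>2 / (16 * D\<^sup>2) \<le> 1" by (simp add: divide_le_eq)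
    then show "0 \<le> r" "r < 1" using c D by (simp_all add: r_def)
  qed
  define st where "st = (\<lambda>n f. lazy_step (V n) (E n) D (f :: 'a \<Rightarrow> complex))"
  have st_sum: "(\<Sum>x\<in>V n. st n f x) = (\<Sum>x\<in>V n. f x)" for n f
    unfolding st_def by (rule sum_lazy_step[OF fin sym D(2,1) c expand])
  have st_contract: "(\<Sum>x\<in>V n. (cmod (st n f x))\<^sup>2) \<le> r * (\<Sum>x\<in>V n. (cmod (f x))\<^sup>2)"
    if "(\<Sum>x\<in>V n. f x) = 0" for n f
    unfolding st_def r_def by (rule lazy_step_contract[OF fin sym D(2,1) c expand that])
  have st_shift: "st n (\<lambda>x. f x - m) x = st n f x - m" for n f m x
    by (simp add: st_def lazy_step_def algebra_simps)
  define M where "M = (\<lambda>\<xi> z. if \<xi> \<in> l2 V \<and> z \<in> Xc V then st (fst z) (\<lambda>x. \<xi> (fst z, x)) (snd z) else 0)"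
  have selfd: "d z z = 0" if "z \<in> Xc V" for z
    using assms(2) that unfolding coarse_union_metric_def by blast
  have MC: "M \<in> Cu V d"
  proof -
    let ?deg = "\<lambda>z. card {y\<in>V (fst z). E (fst z) (snd z) y}"
    let ?b = "\<lambda>z. 1 - complex_of_real (real (?deg z) / (2 * D))"
    let ?A = "\<lambda>\<xi> z. if \<xi> \<in> l2 V \<and> z \<in> Xc V then \<Sum>y\<in>{y\<in>V (fst z). E (fst z) (snd z) y}. \<xi> (fst z, y) else 0"
    \<comment> \<open>The walk splits into a bounded diagonal part, the staying probabilities, and a
      multiple of the adjacency operator.\<close>
    have "M = oadd (mulop V ?b) (oscale (complex_of_real (1 / (2 * D))) ?A)"
    proof (intro ext)
      fix \<xi> z
      show "M \<xi> z = oadd (mulop V ?b) (oscale (complex_of_real (1 / (2 * D))) ?A) \<xi> z"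
      proof (cases "\<xi> \<in> l2 V \<and> z \<in> Xc V")
        case True
        then show ?thesis
          by (simp add: M_def st_def lazy_step_def oadd_def oscale_def mulop_def sum_subtractf
              scaleR_conv_of_real field_simps add_divide_distrib[symmetric])
      next
        case False
        then show ?thesis by (auto simp: M_def oadd_def oscale_def mulop_def l2D_outside)
      qed
    qed
    moreover have "mulop V ?b \<in> Cu V d"
    proof (rule Cu_mulop[OF selfd, where B = 2])
      fix z assume "z \<in> Xc V"
      then have "real (?deg z) \<le> D" using D(2)[of "snd z" "fst z"] by (auto simp: Xc_def)
      then have "real (?deg z) / (2 * D) \<le> 1" "0 \<le> real (?deg z) / (2 * D)" using D(1) by (simp_all add: divide_le_eq)
      then have "cmod (complex_of_real (real (?deg z) / (2 * D))) \<le> 1" by (simp only: norm_of_real abs_of_nonneg)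
      then show "cmod (?b z) \<le> 2"
        using norm_triangle_ineq4[of 1 "complex_of_real (real (?deg z) / (2 * D))"] by simp
    qed
    moreover have "?A \<in> Cu V d" by (rule adjacency_Cu[OF fin graph K assms(2)])
    ultimately show ?thesis by (simp only: Cu_oadd Cu_oscale)
  qed
  define T where "T = (\<lambda>k. ((\<circ>) M ^^ k) (oid V))"
  have T_Suc: "T (Suc k) = M \<circ> T k" for k by (simp add: T_def)
  have TC: "T k \<in> Cu V d" for k
  proof (induction k)
    case 0
    show ?case by (simp add: T_def Cu_oid[OF selfd])
  next
    case (Suc k)
    show ?case unfolding T_Suc by (intro Cu_comp MC Suc.IH)
  qed
  \<comment> \<open>Preservation of block sums belongs in the induction: it keeps the fluctuation
    about \<open>m\<close> of sum zero, as the contraction estimate demands. The factor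
    \<open>r\<close> is the same for every block, which makes the later convergence one in operator
    norm.\<close>
  have block: "(\<Sum>x\<in>V n. T k \<xi> (n, x)) = (\<Sum>x\<in>V n. \<xi> (n, x)) \<and>
      (\<Sum>x\<in>V n. (cmod (T k \<xi> (n, x) - m))\<^sup>2) \<le> r ^ k * (\<Sum>x\<in>V n. (cmod (\<xi> (n, x)))\<^sup>2)"
    if \<xi>: "\<xi> \<in> l2 V" and m: "m = (\<Sum>y\<in>V n. \<xi> (n, y)) / of_nat (card (V n))" for k n \<xi> m
  proof (induction k)
    case 0
    then show ?case using sum_cmod_diff_mean[OF fin, of "\<lambda>x. \<xi> (n, x)" n]
      by (simp add: T_def oid_def \<xi> m)
  next
    case (Suc k)
    let ?f = "\<lambda>x. T k \<xi> (n, x)"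
    have step: "T (Suc k) \<xi> (n, x) = st n ?f x" if "x \<in> V n" for x
      using that bop_l2[OF Cu_bop[OF TC]] by (simp add: T_Suc M_def Xc_def)
    have s: "(\<Sum>x\<in>V n. T (Suc k) \<xi> (n, x)) = (\<Sum>x\<in>V n. \<xi> (n, x))"
      using Suc.IH by (simp add: step st_sum)
    have "of_nat (card (V n)) * m = (\<Sum>x\<in>V n. \<xi> (n, x))"
      using fin[of n] by (cases "V n = {}") (simp_all add: m)
    then have z: "(\<Sum>x\<in>V n. ?f x - m) = 0" using Suc.IH by (simp add: sum_subtractf)
    have "(\<Sum>x\<in>V n. (cmod (T (Suc k) \<xi> (n, x) - m))\<^sup>2) = (\<Sum>x\<in>V n. (cmod (st n (\<lambda>x. ?f x - m) x))\<^sup>2)"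
      by (simp add: step st_shift)
    also have "\<dots> \<le> r * (\<Sum>x\<in>V n. (cmod (?f x - m))\<^sup>2)" by (rule st_contract[OF z])
    also have "\<dots> \<le> r * (r ^ k * (\<Sum>x\<in>V n. (cmod (\<xi> (n, x)))\<^sup>2))"
      using Suc.IH r(1) by (intro mult_left_mono) auto
    finally show ?case using s by (simp add: mult.assoc)
  qed
  have norm: "opnorm V (odiff (ghost_proj V) (T k)) \<le> sqrt r ^ k" for k
  proof (rule opnorm_leI)
    fix \<xi> assume \<xi>: "\<xi> \<in> l2 V"
    have T0: "T k \<xi> z = 0" if "z \<notin> Xc V" for z
      using l2D_outside[OF bop_l2[OF Cu_bop[OF TC]] that] .
    show "l2norm V (odiff (ghost_proj V) (T k) \<xi>) \<le> sqrt r ^ k * l2norm V \<xi>"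
    proof (rule l2norm_blockwise[OF fin \<xi>])
      show "odiff (ghost_proj V) (T k) \<xi> z = 0" if "z \<notin> Xc V" for z
        using that by (simp add: odiff_def ghost_proj_outside T0)
      show "(\<Sum>x\<in>V n. (cmod (odiff (ghost_proj V) (T k) \<xi> (n, x)))\<^sup>2) \<le> (sqrt r ^ k)\<^sup>2 * (\<Sum>x\<in>V n. (cmod (\<xi> (n, x)))\<^sup>2)" for n
      proof -
        have "(sqrt r ^ k)\<^sup>2 = r ^ k" using r(1) by (simp add: power_mult[symmetric] mult.commute[of k] power_mult)
        then show ?thesis
          using conjunct2[OF block[OF \<xi> refl, of k n]]
          by (simp add: odiff_def ghost_proj_apply[OF \<xi>] norm_minus_commute)
      qed
    qed (use r(1) in simp)
  qed (use r(1) in simp)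
  show ?thesis
  proof (rule Cu_closed[OF bop_ghost_proj[OF fin]])
    fix e :: real assume "0 < e"
    have "sqrt r < 1" using r by simp
    then obtain k where "sqrt r ^ k < e" using real_arch_pow_inv[OF \<open>0 < e\<close>] by blast
    then show "\<exists>a\<in>Cu V d. opnorm V (odiff (ghost_proj V) a) < e"
      using norm[of k] TC by (intro bexI[of _ "T k"]) auto
  qed
qed


subsection \<open>The unitary group generated by the ghost projections\<close>

text \<open>The purely algebraic part: a one-parameter group of unitaries inside the algebra acts by
  inner automorphisms, with no continuity in \<open>t\<close> involved.\<close>

lemma preflow_conj:
  assumes U: "\<And>t. U t \<in> Cu V d" and comp: "\<And>s t. U s \<circ> U t = U (s + t)"
    and zero: "U 0 = oid V" and adj: "\<And>t. adj V (U t) = U (- t)"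
  shows "preflow V (Cu V d) (\<lambda>t a. U t \<circ> a \<circ> U (- t))"
proof -
  have [simp]: "bop V (U t)" for t using Cu_bop[OF U] .
  have inv: "U t \<circ> U (- t) = oid V" "U (- t) \<circ> U t = oid V" for t
    using comp[of t "- t"] comp[of "- t" t] zero by simp_all
  have closed: "U t \<circ> a \<circ> U (- t) \<in> Cu V d" if "a \<in> Cu V d" for a t
    by (intro Cu_comp U that)
  have back_forth: "U (- t) \<circ> (U t \<circ> a \<circ> U (- t)) \<circ> U t = a" if "bop V a" for a t
  proof -
    have "U (- t) \<circ> (U t \<circ> a \<circ> U (- t)) \<circ> U t = (U (- t) \<circ> U t) \<circ> a \<circ> (U (- t) \<circ> U t)"
      by (simp only: comp_assoc)
    then show ?thesis by (simp only: inv oid_comp that)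
  qed
  have aut: "star_aut V (Cu V d) (\<lambda>a. U t \<circ> a \<circ> U (- t))" for t
    unfolding star_aut_def
  proof (intro conjI ballI allI)
    show "bij_betw (\<lambda>a. U t \<circ> a \<circ> U (- t)) (Cu V d) (Cu V d)"
    proof (rule bij_betw_byWitness[where f' = "\<lambda>a. U (- t) \<circ> a \<circ> U t"])
      show "\<forall>a\<in>Cu V d. U (- t) \<circ> (U t \<circ> a \<circ> U (- t)) \<circ> U t = a"
        using back_forth Cu_bop by blast
      show "\<forall>a\<in>Cu V d. U t \<circ> (U (- t) \<circ> a \<circ> U t) \<circ> U (- t) = a"
        using back_forth[of _ "- t"] Cu_bop by fastforce
      show "(\<lambda>a. U t \<circ> a \<circ> U (- t)) ` Cu V d \<subseteq> Cu V d" using closed by blast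
      show "(\<lambda>a. U (- t) \<circ> a \<circ> U t) ` Cu V d \<subseteq> Cu V d" using closed[of _ "- t"] by auto
    qed
  next
    fix a b assume ab: "a \<in> Cu V d" "b \<in> Cu V d"
    then have bop: "bop V a" "bop V b" by (auto intro: Cu_bop)
    show "U t \<circ> oadd a b \<circ> U (- t) = oadd (U t \<circ> a \<circ> U (- t)) (U t \<circ> b \<circ> U (- t))"
      by (simp add: fun_eq_iff oadd_def bop_add[of V "U t"] bop_l2 bop)
    have "(U t \<circ> a \<circ> U (- t)) \<circ> (U t \<circ> b \<circ> U (- t)) = U t \<circ> a \<circ> ((U (- t) \<circ> U t) \<circ> b) \<circ> U (- t)"
      by (simp only: comp_assoc)
    then show "U t \<circ> (a \<circ> b) \<circ> U (- t) = (U t \<circ> a \<circ> U (- t)) \<circ> (U t \<circ> b \<circ> U (- t))"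
      by (simp only: inv oid_comp bop) (simp only: comp_assoc)
  next
    fix a c assume "a \<in> Cu V d"
    then show "U t \<circ> oscale c a \<circ> U (- t) = oscale c (U t \<circ> a \<circ> U (- t))"
      by (simp add: fun_eq_iff oscale_def bop_scale[of V "U t"] bop_l2[of V a] Cu_bop)
  next
    fix a assume "a \<in> Cu V d"
    then show "U t \<circ> adj V a \<circ> U (- t) = adj V (U t \<circ> a \<circ> U (- t))"
      by (simp add: adj_comp bop_comp Cu_bop adj comp_assoc)
  qed
  have "U (s + t) \<circ> a \<circ> U (- (s + t)) = U s \<circ> (U t \<circ> a \<circ> U (- t)) \<circ> U (- s)" for s t a
  proof -
    have "U s \<circ> (U t \<circ> a \<circ> U (- t)) \<circ> U (- s) = (U s \<circ> U t) \<circ> a \<circ> (U (- t) \<circ> U (- s))"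
      by (simp only: comp_assoc)
    then show ?thesis by (simp add: comp add.commute)
  qed
  moreover have "U 0 \<circ> a \<circ> U (- 0) = a" if "a \<in> Cu V d" for a
    using that by (simp add: zero oid_comp Cu_bop bop_comp)
  ultimately show ?thesis using aut unfolding preflow_def by blast
qed

section \<open>The unitaries exp(ith) in terms of block means\<close>

lemma exp_ith_apply:
  assumes "\<xi> \<in> l2 V" "x \<in> V n"
  shows "exp_ith V w t \<xi> (n, x) = \<xi> (n, x) + (cis (t * w n) - 1) * ((\<Sum>y\<in>V n. \<xi> (n, y)) / of_nat (card (V n)))"
  using assms by (simp add: exp_ith_def oid_def avgproj_def Xc_def cis_conv_exp)

lemma exp_ith_outside: "\<xi> \<notin> l2 V \<or> z \<notin> Xc V \<Longrightarrow> exp_ith V w t \<xi> z = 0"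
  by (auto simp: exp_ith_def oid_def avgproj_def l2D_outside)

text \<open>Left unnormalised, so that pointwise lower bounds on an image can be counted against
  \<open>card (V n)\<close>.\<close>

definition block_one :: "(nat \<Rightarrow> 'a set) \<Rightarrow> nat \<Rightarrow> 'a vec" where
  "block_one V n = (\<lambda>z. of_bool (z \<in> Xc V \<and> fst z = n))"

context
  fixes V :: "nat \<Rightarrow> 'a set" and E :: "nat \<Rightarrow> 'a \<Rightarrow> 'a \<Rightarrow> bool"
    and d :: "nat \<times> 'a \<Rightarrow> nat \<times> 'a \<Rightarrow> real" and w :: "nat \<Rightarrow> real"
  assumes expander: "expander_seq V E" and metric: "coarse_union_metric V E d"
begin

lemma finite_block: "finite (V n)" and block_nonempty: "V n \<noteq> {}"
  using expander by (auto simp: expander_seq_def graph_connected_def)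

lemma card_block_nonzero: "card (V n) \<noteq> 0"
  using finite_block block_nonempty by simp

lemma metric_self: "z \<in> Xc V \<Longrightarrow> d z z = 0"
  using metric unfolding coarse_union_metric_def by blast

text \<open>However fast \<open>w\<close> grows, the multiplier \<open>cis (t * w n) - 1\<close> has
  modulus at most 2, so it gives an element of the algebra to be composed with the ghost
  projection.\<close>

lemma exp_ith_Cu: "exp_ith V w t \<in> Cu V d"
proof -
  let ?b = "\<lambda>z. cis (t * w (fst z)) - 1"
  have "mulop V ?b \<in> Cu V d"
  proof (rule Cu_mulop[OF metric_self, where B = 2])
    fix z :: "nat \<times> 'a" show "cmod (?b z) \<le> 2"
      using norm_triangle_ineq4[of "cis (t * w (fst z))" 1] by simp
  qed
  then have "oadd (oid V) (mulop V ?b \<circ> ghost_proj V) \<in> Cu V d"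
    by (intro Cu_oadd Cu_comp Cu_oid[OF metric_self] ghost_proj_Cu[OF expander metric])
  moreover have "exp_ith V w t = oadd (oid V) (mulop V ?b \<circ> ghost_proj V)"
    using bop_l2[OF bop_ghost_proj, of V] finite_block
    by (simp add: fun_eq_iff exp_ith_def oadd_def mulop_def ghost_proj_def[symmetric] cis_conv_exp) (simp add: ghost_proj_def)
  ultimately show ?thesis by simp
qed

lemma bop_exp_ith: "bop V (exp_ith V w t)"
  by (rule Cu_bop[OF exp_ith_Cu])

lemma sum_exp_ith:
  assumes "\<xi> \<in> l2 V"
  shows "(\<Sum>x\<in>V n. exp_ith V w t \<xi> (n, x)) = cis (t * w n) * (\<Sum>x\<in>V n. \<xi> (n, x))"
  using card_block_nonzero[of n] by (simp add: exp_ith_apply[OF assms] sum.distrib, simp add: field_simps)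

lemma exp_ith_comp: "exp_ith V w s \<circ> exp_ith V w t = exp_ith V w (s + t)"
proof (intro ext)
  fix \<xi> z
  show "(exp_ith V w s \<circ> exp_ith V w t) \<xi> z = exp_ith V w (s + t) \<xi> z"
  proof (cases "\<xi> \<in> l2 V \<and> z \<in> Xc V")
    case True
    obtain n x where z: "z = (n, x)" "x \<in> V n" using True by (auto simp: Xc_def)
    define m where "m = (\<Sum>y\<in>V n. \<xi> (n, y)) / of_nat (card (V n))"
    have "(exp_ith V w s \<circ> exp_ith V w t) \<xi> z = exp_ith V w t \<xi> (n, x) + (cis (s * w n) - 1) * (cis (t * w n) * m)"
      using True
      by (simp only: comp_apply z exp_ith_apply[OF bop_l2[OF bop_exp_ith] z(2), where t = s] sum_exp_ith m_def times_divide_eq_right)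
    also have "\<dots> = \<xi> (n, x) + (cis (s * w n) * cis (t * w n) - 1) * m"
      using True z(2) by (simp add: exp_ith_apply m_def[symmetric] algebra_simps)
    also have "cis (s * w n) * cis (t * w n) = cis ((s + t) * w n)" by (simp add: cis_mult distrib_right)
    also have "\<xi> (n, x) + (cis ((s + t) * w n) - 1) * m = exp_ith V w (s + t) \<xi> z"
      using True z(2) by (simp only: z exp_ith_apply m_def)
    finally show ?thesis .
  next
    case False
    then show ?thesis
      using bop_zero[OF bop_exp_ith, of s] bop_outside[OF bop_exp_ith, of \<xi> t]
      by (auto simp: exp_ith_outside)
  qed
qed

lemma exp_ith_zero: "exp_ith V w 0 = oid V"
  by (simp add: exp_ith_def)

text \<open>These coefficients are symmetric in the two points, so the adjoint amounts to
  conjugating \<open>cis\<close>. At a half turn the diagonal entry is 1 - 2/|V n|, the quantity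
  compared with 1 in the cocycle argument.\<close>

lemma exp_ith_unit_vec:
  assumes "a \<in> V n" "b \<in> V m"
  shows "exp_ith V w t (unit_vec (n, a)) (m, b) = of_bool (n = m \<and> a = b) + of_bool (n = m) * (cis (t * w m) - 1) / of_nat (card (V m))"
proof -
  have "(\<Sum>y\<in>V m. unit_vec (n, a) (m, y)) = of_bool (n = m)"
    using assms finite_block by (auto simp: unit_vec_def)
  then show ?thesis
    using assms by (subst exp_ith_apply) (auto simp: unit_vec_l2 Xc_def, auto simp: unit_vec_def)
qed

lemma adj_exp_ith: "adj V (exp_ith V w t) = exp_ith V w (- t)"
proof (rule adj_eqI_coeff[OF bop_exp_ith bop_exp_ith])
  fix x y assume "x \<in> Xc V" "y \<in> Xc V"
  then obtain n a m b where "x = (n, a)" "y = (m, b)" "a \<in> V n" "b \<in> V m" by (auto simp: Xc_def)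
  then show "exp_ith V w (- t) (unit_vec x) y = cnj (exp_ith V w t (unit_vec y) x)"
    by (auto simp: exp_ith_unit_vec cis_cnj)
qed

lemma preflow_sigma_h: "preflow V (Cu V d) (sigma_h V w)"
proof -
  have "sigma_h V w = (\<lambda>t a. exp_ith V w t \<circ> a \<circ> exp_ith V w (- t))"
    by (simp add: fun_eq_iff sigma_h_def)
  then show ?thesis using preflow_conj[OF exp_ith_Cu exp_ith_comp exp_ith_zero adj_exp_ith] by simp
qed

subsection \<open>Discontinuity\<close>

lemma block_one_l2: "block_one V n \<in> l2 V" and l2norm_block_one: "(l2norm V (block_one V n))\<^sup>2 = card (V n)"
proof -
  have F: "finite ({n} \<times> V n)" "{n} \<times> V n \<subseteq> Xc V" "\<And>z. z \<notin> {n} \<times> V n \<Longrightarrow> block_one V n z = 0"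
    using finite_block by (auto simp: Xc_def block_one_def)
  show "block_one V n \<in> l2 V" by (rule l2_finite_support(1)[OF F])
  have "(l2norm V (block_one V n))\<^sup>2 = (\<Sum>z\<in>{n} \<times> V n. (cmod (block_one V n z))\<^sup>2)"
    by (rule l2_finite_support(2)[OF F])
  also have "\<dots> = (\<Sum>z\<in>{n} \<times> V n. 1)"
    by (intro sum.cong) (auto simp: block_one_def Xc_def)
  also have "\<dots> = card (V n)" using finite_block by (simp add: card_cartesian_product)
  finally show "(l2norm V (block_one V n))\<^sup>2 = card (V n)" .
qed

text \<open>The image of the constant vector has squared norm at least |H| and at most the square of
  \<open>e\<close> times |V n|. Both discontinuity arguments end here, with \<open>H\<close> too
  large a part of the block.\<close>

lemma opnorm_less_block_one:
  assumes T: "bop V T" "opnorm V T < e" and H: "H \<subseteq> V n"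
    and ge: "\<And>x. x \<in> H \<Longrightarrow> 1 \<le> cmod (T (block_one V n) (n, x))"
  shows "real (card H) \<le> e\<^sup>2 * real (card (V n))"
proof -
  let ?\<xi> = "block_one V n"
  have "l2norm V (T ?\<xi>) \<le> opnorm V T * l2norm V ?\<xi>" by (rule l2norm_le_opnorm[OF T(1) block_one_l2])
  also have "\<dots> \<le> e * l2norm V ?\<xi>" using T(2) by (intro mult_right_mono) auto
  finally have le: "(l2norm V (T ?\<xi>))\<^sup>2 \<le> (e * l2norm V ?\<xi>)\<^sup>2" by (rule power_mono) simp
  have finH: "finite H" using finite_block H finite_subset by blast
  have "real (card H) = (\<Sum>z\<in>{n} \<times> H. 1)" using finH by (simp add: card_cartesian_product)
  also have "\<dots> \<le> (\<Sum>z\<in>{n} \<times> H. (cmod (T ?\<xi> z))\<^sup>2)"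
    using ge by (intro sum_mono) (auto intro: one_le_power)
  also have "\<dots> \<le> (l2norm V (T ?\<xi>))\<^sup>2"
    using finH H by (intro sum_le_l2norm_sq bop_l2[OF T(1)]) (auto simp: Xc_def)
  also have "\<dots> \<le> e\<^sup>2 * real (card (V n))" using le by (simp add: power_mult_distrib l2norm_block_one)
  finally show ?thesis .
qed

lemma exp_ith_block_one: "exp_ith V w t (block_one V n) = (\<lambda>z. cis (t * w n) * block_one V n z)"
proof
  fix z
  show "exp_ith V w t (block_one V n) z = cis (t * w n) * block_one V n z"
  proof (cases "z \<in> Xc V")
    case True
    then obtain m x where z: "z = (m, x)" "x \<in> V m" by (auto simp: Xc_def)
    have "(\<Sum>y\<in>V m. block_one V n (m, y)) = (\<Sum>y\<in>V m. of_bool (m = n))"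
      by (intro sum.cong) (auto simp: block_one_def Xc_def)
    then have "(\<Sum>y\<in>V m. block_one V n (m, y)) = of_nat (card (V m)) * of_bool (m = n)" by simp
    then show ?thesis using z card_block_nonzero[of m] by (simp add: exp_ith_apply block_one_l2) (auto simp: block_one_def Xc_def)
  qed (simp add: exp_ith_outside block_one_def)
qed

context
  assumes unbounded: "\<not> bdd_above (range (\<lambda>n. \<bar>w n\<bar>))"
begin

text \<open>Discarding finitely many blocks leaves \<open>w\<close> unbounded, so large weights
  occur among the blocks with at least 4 vertices. That size makes half of a block exceed a quarter
  of it and keeps 1 - 2/|V n| positive.\<close>

lemma large_weight: obtains n where "4 \<le> card (V n)" "B < \<bar>w n\<bar>"
proof -
  have "\<forall>\<^sub>F n in sequentially. 4 \<le> card (V n)"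
    using expander by (simp add: expander_seq_def filterlim_at_top)
  then obtain m where m: "\<And>n. m \<le> n \<Longrightarrow> 4 \<le> card (V n)" by (auto simp: eventually_sequentially)
  have "\<exists>n\<ge>m. B < \<bar>w n\<bar>"
  proof (rule ccontr)
    assume "\<not> ?thesis"
    then have "(\<lambda>n. \<bar>w n\<bar>) ` {m..} \<subseteq> {..B}" by auto
    then have "bdd_above ((\<lambda>n. \<bar>w n\<bar>) ` {m..})" by (rule bdd_above_mono[OF bdd_above_Iic])
    moreover have "bdd_above ((\<lambda>n. \<bar>w n\<bar>) ` {..<m})" by simp
    moreover have "UNIV = {..<m} \<union> {m..}" by auto
    then have "range (\<lambda>n. \<bar>w n\<bar>) = (\<lambda>n. \<bar>w n\<bar>) ` {..<m} \<union> (\<lambda>n. \<bar>w n\<bar>) ` {m..}"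
      by (metis image_Un)
    ultimately show False using unbounded by simp
  qed
  then show thesis using that m by blast
qed

text \<open>The time is \<open>pi / w n\<close>, of either sign; a weight beyond
  \<open>pi / \<delta>\<close> in modulus brings it within \<open>\<delta>\<close> of 0.\<close>

lemma half_turn:
  assumes "0 < \<delta>"
  obtains n t where "4 \<le> card (V n)" "\<bar>t\<bar> < \<delta>" "t * w n = pi"
proof -
  obtain n where n: "4 \<le> card (V n)" "pi / \<delta> < \<bar>w n\<bar>" by (rule large_weight)
  have "0 < pi / \<delta>" using assms by simp
  then have "w n \<noteq> 0" using n(2) by auto
  moreover have "\<bar>pi / w n\<bar> < \<delta>" using n(2) assms \<open>w n \<noteq> 0\<close> by (simp add: field_simps)
  ultimately show thesis using that[of n "pi / w n"] n(1) by simp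
qed

text \<open>The projection onto half of every block fails to commute with the averaging projections
  by a fixed amount, which a half turn on a late block detects.\<close>
lemma not_flow_sigma_h: "\<not> flow V (Cu V d) (sigma_h V w)"
proof
  assume flow: "flow V (Cu V d) (sigma_h V w)"
  have "\<forall>n. \<exists>H. H \<subseteq> V n \<and> card H = card (V n) div 2"
    by (meson obtain_subset_with_card_n div_le_dividend)
  then obtain H where H: "\<And>n. H n \<subseteq> V n" "\<And>n. card (H n) = card (V n) div 2" by metis
  define A where "A = (SIGMA n:UNIV. H n)"
  define q where "q = mulop V (\<lambda>z. of_bool (z \<in> A))"
  have "A \<subseteq> Xc V" using H(1) by (auto simp: A_def Xc_def)
  then have q: "q \<in> Cu V d" unfolding q_def by (intro Cu_indicator metric_self)
  have "norm_continuous V (\<lambda>t. sigma_h V w t q)" using flow q by (simp add: flow_def)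
  then obtain \<delta> where \<delta>: "0 < \<delta>"
    "\<And>t. \<bar>t - 0\<bar> < \<delta> \<Longrightarrow> opnorm V (odiff (sigma_h V w t q) (sigma_h V w 0 q)) < 1 / 2"
    unfolding norm_continuous_def by (metis half_gt_zero zero_less_one)
  obtain n t where n: "4 \<le> card (V n)" "\<bar>t\<bar> < \<delta>" "t * w n = pi" by (rule half_turn[OF \<delta>(1)])
  have q0: "sigma_h V w 0 q = q" using preflow_sigma_h q by (simp add: preflow_def)
  define T where "T = odiff (sigma_h V w t q) q"
  have bopT: "bop V T"
    unfolding T_def sigma_h_def by (intro bop_odiff bop_comp bop_exp_ith Cu_bop[OF q])
  \<comment> \<open>The inner exponential negates the constant vector and \<open>q\<close> cuts it
    down to the chosen half, leaving \<open>?\<eta>\<close> for the outer exponential.\<close>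
  let ?\<xi> = "block_one V n" and ?\<eta> = "\<lambda>z. - of_bool (z \<in> A \<and> fst z = n) :: complex"
  have "sigma_h V w t q ?\<xi> = exp_ith V w t (q (\<lambda>z. - 1 * ?\<xi> z))"
  proof -
    have "cis (- t * w n) = - 1" using n(3) by (simp add: complex_eq_iff)
    then show ?thesis by (simp only: sigma_h_def comp_apply exp_ith_block_one)
  qed
  also have "q (\<lambda>z. - 1 * ?\<xi> z) = ?\<eta>"
    using l2_scale[OF block_one_l2, of "- 1" n] \<open>A \<subseteq> Xc V\<close> by (auto simp: q_def mulop_def block_one_def fun_eq_iff)
  finally have \<sigma>: "sigma_h V w t q ?\<xi> = exp_ith V w t ?\<eta>" .
  have \<eta>: "?\<eta> \<in> l2 V"
    using \<open>A \<subseteq> Xc V\<close> by (intro l2_dominated[OF block_one_l2[of n], of _ 1]) (auto simp: block_one_def)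
  have "1 \<le> cmod (T ?\<xi> (n, x))" if x: "x \<in> H n" for x
  proof -
    have xV: "x \<in> V n" using x H(1) by blast
    have sum\<eta>: "(\<Sum>y\<in>V n. ?\<eta> (n, y)) = - of_nat (card (H n))"
    proof -
      have "(\<Sum>y\<in>V n. ?\<eta> (n, y)) = - (\<Sum>y\<in>V n. of_bool (y \<in> H n))"
        by (simp add: A_def sum_negf)
      also have "(\<Sum>y\<in>V n. of_bool (y \<in> H n)) = complex_of_nat (card (H n))"
        using finite_block H(1)[of n] by (simp add: of_bool_def sum.If_cases Int_absorb1)
      finally show ?thesis .
    qed
    have "cis (t * w n) = - 1" using n(3) by simp
    \<comment> \<open>The reflection 1 - 2p adds twice the mean |H|/|V n|, at most 1 in total.
      Subtracting the value 1 of \<open>q\<close> then leaves a real number that is at most -1 on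
      all of \<open>H\<close>.\<close>
    then have "exp_ith V w t ?\<eta> (n, x) = - 1 + 2 * (of_nat (card (H n)) / of_nat (card (V n)))"
      using x by (simp only: exp_ith_apply[OF \<eta> xV] sum\<eta>) (simp add: A_def)
    moreover have "q ?\<xi> (n, x) = 1"
      using x xV block_one_l2[of n] by (simp add: q_def mulop_def A_def) (simp add: block_one_def Xc_def)
    ultimately have "T ?\<xi> (n, x) = - 2 + of_real (2 * (real (card (H n)) / real (card (V n))))"
      unfolding T_def odiff_def \<sigma> by simp
    then have "Re (T ?\<xi> (n, x)) = - 2 + 2 * (real (card (H n)) / real (card (V n)))" by simp
    moreover have "real (card (H n)) / real (card (V n)) \<le> 1 / 2"
      using n(1) H(2)[of n] by (simp add: divide_le_eq)
    ultimately show ?thesis using abs_Re_le_cmod[of "T ?\<xi> (n, x)"] by linarith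
  qed
  then have "real (card (H n)) \<le> (1 / 2)\<^sup>2 * real (card (V n))"
    using opnorm_less_block_one[OF bopT _ H(1)] \<delta>(2)[of t] n(2) by (simp add: T_def q0)
  then have "4 * card (H n) \<le> card (V n)" by (simp add: power2_eq_square)
  then show False using n(1) unfolding H(2) by linarith
qed

text \<open>Diagonal flows fix the diagonal projections, so the cocycle unitary at time \<open>t\<close> maps every
  unit vector to a multiple of its image under the exponential of \<open>i t h\<close>. Near the identity those
  multiples are forced to be almost 1, whereas a half turn negates the constant vector of a block.\<close>
lemma not_cocycle_perturbation_diag: "\<not> cocycle_perturbation_of V (Cu V d) (sigma_h V w) (sigma_diag V k)"
proof
  assume "cocycle_perturbation_of V (Cu V d) (sigma_h V w) (sigma_diag V k)"
  then obtain u where u: "\<And>t. unitary_in V (Cu V d) (u t)" and cont: "norm_continuous V u"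
    and cocycle: "\<And>s t. u (t + s) = u t \<circ> sigma_diag V k t (u s)"
    and pert: "\<And>t a. a \<in> Cu V d \<Longrightarrow> sigma_h V w t a = u t \<circ> sigma_diag V k t a \<circ> adj V (u t)"
    unfolding cocycle_perturbation_of_def cocycle_def by blast
  have uC: "u t \<in> Cu V d" and u_inv: "adj V (u t) \<circ> u t = oid V" for t
    using u[of t] by (simp_all add: unitary_in_def)
  have bopu: "bop V (u t)" for t by (rule Cu_bop[OF uC])
  have "exp_itk V k 0 = oid V" by (simp add: exp_itk_def)
  then have "sigma_diag V k 0 (u 0) = u 0" by (simp add: sigma_diag_def oid_comp bopu)
  \<comment> \<open>The cocycle identity at time 0 makes \<open>u 0\<close> idempotent, and an
    invertible idempotent is the identity.\<close>
  then have "u 0 = u 0 \<circ> u 0" using cocycle[of 0 0] by simp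
  then have "adj V (u 0) \<circ> u 0 = (adj V (u 0) \<circ> u 0) \<circ> u 0" by (metis comp_assoc)
  then have u0: "u 0 = oid V" by (simp add: u_inv oid_comp bopu)
  \<comment> \<open>With 1/4, the errors met below are at most 1/4 from a single entry and 1/2 from
    twice a mean; together they stay below 1.\<close>
  obtain \<delta> where \<delta>: "0 < \<delta>" "\<And>t. \<bar>t - 0\<bar> < \<delta> \<Longrightarrow> opnorm V (odiff (u t) (u 0)) < 1 / 4"
    using cont unfolding norm_continuous_def by (metis zero_less_divide_1_iff zero_less_numeral)
  obtain n t where n: "4 \<le> card (V n)" "\<bar>t\<bar> < \<delta>" "t * w n = pi" by (rule half_turn[OF \<delta>(1)])
  define T where "T = odiff (u t) (oid V)"
  have T: "bop V T" "opnorm V T < 1 / 4"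
    using \<delta>(2)[of t] n(2) by (simp_all add: T_def u0 bop_odiff bopu bop_oid)
  have "\<exists>\<mu>. u t (unit_vec y) = (\<lambda>z. \<mu> * exp_ith V w t (unit_vec y) z)" if y: "y \<in> Xc V" for y
  proof -
    define q where "q = mulop V (\<lambda>z. of_bool (z \<in> {y}))"
    have q: "q \<in> Cu V d" unfolding q_def using y by (intro Cu_indicator[OF metric_self]) auto
    have "sigma_diag V k t q = q"
    proof (intro ext)
      fix \<xi> z
      have c: "cis (t * k z) * cis (- (t * k z)) = 1" for z by (simp add: cis_mult)
      have l2: "(\<lambda>z. cis (- (t * k z)) * \<xi> z) \<in> l2 V" "q \<xi> \<in> l2 V" if "\<xi> \<in> l2 V" for \<xi>
        using that bop_l2[OF Cu_bop[OF q]] by (auto intro!: l2_dominated[OF that, of _ 1] simp: norm_mult)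
      show "sigma_diag V k t q \<xi> z = q \<xi> z"
      proof (cases "\<xi> \<in> l2 V")
        case True
        have e: "exp_itk V k s \<zeta> = (\<lambda>z. cis (s * k z) * \<zeta> z)" if "\<zeta> \<in> l2 V" for s \<zeta>
          using that by (simp add: exp_itk_def oid_def cis_conv_exp)
        have "sigma_diag V k t q \<xi> z = cis (t * k z) * q (\<lambda>z. cis (- (t * k z)) * \<xi> z) z"
          using l2 True by (simp add: sigma_diag_def e)
        then show ?thesis using l2(1)[OF True] True c[of z] by (simp add: q_def mulop_def)
      next
        case False
        have e: "exp_itk V k s (\<lambda>_. 0) = (\<lambda>_. 0)" "exp_itk V k s \<xi> = (\<lambda>_. 0)" for s
          using False by (simp_all add: exp_itk_def oid_def)
        show ?thesis
          using False by (simp add: sigma_diag_def e bop_zero[OF Cu_bop[OF q]] bop_outside[OF Cu_bop[OF q]])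
      qed
    qed
    then have "exp_ith V w t \<circ> q \<circ> exp_ith V w (- t) \<circ> u t = u t \<circ> q \<circ> (adj V (u t) \<circ> u t)"
      using pert[OF q, of t] by (simp only: sigma_h_def comp_assoc)
    \<comment> \<open>Applied to the unit vector at \<open>y\<close>, the right side is
      \<open>u t (unit_vec y)\<close>, while on the left the rank-one \<open>q\<close> leaves only a
      multiple of \<open>unit_vec y\<close> for \<open>exp_ith\<close> to act on.\<close>
    then have eq: "exp_ith V w t \<circ> q \<circ> exp_ith V w (- t) \<circ> u t = u t \<circ> q"
      by (simp add: u_inv oid_comp bop_comp bopu Cu_bop[OF q])
    define \<zeta> where "\<zeta> = exp_ith V w (- t) (u t (unit_vec y))"
    have "\<zeta> \<in> l2 V" unfolding \<zeta>_def by (rule bop_l2[OF bop_exp_ith])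
    then have "q \<zeta> = (\<lambda>z. \<zeta> y * unit_vec y z)" by (auto simp: q_def mulop_def unit_vec_def)
    moreover have "q (unit_vec y) = unit_vec y"
      using unit_vec_l2[OF y] by (auto simp: q_def mulop_def unit_vec_def)
    ultimately have "u t (unit_vec y) = exp_ith V w t (\<lambda>z. \<zeta> y * unit_vec y z)"
      using fun_cong[OF eq, of "unit_vec y"] by (simp add: \<zeta>_def)
    then show ?thesis using bop_scale[OF bop_exp_ith unit_vec_l2[OF y]] by auto
  qed
  then obtain \<mu> where \<mu>: "\<And>y. y \<in> Xc V \<Longrightarrow> u t (unit_vec y) = (\<lambda>z. \<mu> y * exp_ith V w t (unit_vec y) z)"
    by metis
  define N where "N = real (card (V n))"
  define s where "s = 1 - 2 / N"
  have N: "4 \<le> N" using n(1) by (simp add: N_def)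
  have s: "0 < s" using N by (simp add: s_def field_simps)
  \<comment> \<open>The diagonal entry of \<open>u t\<close> at \<open>(n, y)\<close>:
    \<open>s\<close> is the diagonal entry of the half turn and \<open>\<mu>\<close> the unknown
    multiple.\<close>
  define \<nu> where "\<nu> = (\<lambda>y. s * \<mu> (n, y))"
  have X: "(n, y) \<in> Xc V" if "y \<in> V n" for y using that by (simp add: Xc_def)
  have \<nu>: "cmod (\<nu> y - 1) \<le> 1 / 4" if y: "y \<in> V n" for y
  proof -
    have "T (unit_vec (n, y)) (n, y) = \<nu> y - 1"
      using y n(3) by (simp add: T_def odiff_def oid_def unit_vec_l2 X \<mu> exp_ith_unit_vec \<nu>_def s_def N_def)
        (simp add: unit_vec_def)
    then have "cmod (\<nu> y - 1) \<le> l2norm V (T (unit_vec (n, y)))"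
      using cmod_le_l2norm[OF bop_l2[OF T(1)]] by metis
    also have "\<dots> \<le> opnorm V T"
      using l2norm_le_opnorm[OF T(1) unit_vec_l2[OF X[OF y]]] by (simp add: l2norm_unit_vec X[OF y])
    finally show ?thesis using T(2) by simp
  qed
  have "1 \<le> cmod (T (block_one V n) (n, x))" if x: "x \<in> V n" for x
  proof -
    have "block_one V n = (\<lambda>z. \<Sum>y\<in>V n. unit_vec (n, y) z)"
    proof
      fix z show "block_one V n z = (\<Sum>y\<in>V n. unit_vec (n, y) z)"
        using finite_block by (cases z; cases "fst z = n") (auto simp: block_one_def unit_vec_def Xc_def)
    qed
    then have "u t (block_one V n) (n, x) = (\<Sum>y\<in>V n. u t (unit_vec (n, y)) (n, x))"
      by (simp add: bop_sum[OF bopu finite_block] unit_vec_l2 X)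
    also have "\<dots> = (\<Sum>y\<in>V n. (if y = x then \<mu> (n, y) else 0) - 2 / N * \<mu> (n, y))"
      using x n(3) by (intro sum.cong) (auto simp: \<mu> X exp_ith_unit_vec N_def algebra_simps)
    also have "\<dots> = \<mu> (n, x) - 2 / N * (\<Sum>y\<in>V n. \<mu> (n, y))"
      using x finite_block by (simp add: sum_subtractf sum_distrib_left)
    finally have "T (block_one V n) (n, x) = \<mu> (n, x) - 2 / N * (\<Sum>y\<in>V n. \<mu> (n, y)) - 1"
      using x by (simp add: T_def odiff_def oid_def block_one_l2) (simp add: block_one_def X)
    then have "s * T (block_one V n) (n, x) = \<nu> x - 2 / N * (\<Sum>y\<in>V n. \<nu> y) - s"
      by (simp add: \<nu>_def sum_distrib_left[symmetric] right_diff_distrib)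
    \<comment> \<open>Replacing every \<open>\<nu>\<close> by 1 gives 1 - 2 - s = -(1 + s), the
      effect of negating the constant vector; what remains are deviations from 1 known to be
      small.\<close>
    also have "\<dots> = (\<nu> x - 1) - 2 / N * (\<Sum>y\<in>V n. \<nu> y - 1) - of_real (1 + s)"
    proof -
      have "of_nat (card (V n)) = complex_of_real N" by (simp add: N_def)
      then show ?thesis using N by (simp add: sum_subtractf algebra_simps)
    qed
    finally have eq: "of_real (1 + s) = (\<nu> x - 1) - 2 / N * (\<Sum>y\<in>V n. \<nu> y - 1) - s * T (block_one V n) (n, x)"
      by simp
    have "cmod (\<Sum>y\<in>V n. \<nu> y - 1) \<le> (\<Sum>y\<in>V n. 1 / 4)" by (rule sum_norm_le) (rule \<nu>)
    then have "2 / N * cmod (\<Sum>y\<in>V n. \<nu> y - 1) \<le> 2 / N * (N * (1 / 4))"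
      using N by (intro mult_left_mono) (simp_all add: N_def)
    then have S: "cmod (2 / N * (\<Sum>y\<in>V n. \<nu> y - 1)) \<le> 1 / 2" using N by (simp add: norm_mult norm_divide)
    have "1 + s = cmod (of_real (1 + s))" unfolding norm_of_real using s by simp
    also have "\<dots> \<le> cmod (\<nu> x - 1) + cmod (2 / N * (\<Sum>y\<in>V n. \<nu> y - 1)) + cmod (s * T (block_one V n) (n, x))"
      unfolding eq by (meson norm_triangle_ineq4 order_trans add_right_mono)
    finally have "s \<le> cmod (s * T (block_one V n) (n, x))" using \<nu>[OF x] S by linarith
    then show ?thesis using s by (simp add: norm_mult)
  qed
  then have "real (card (V n)) \<le> (1 / 4)\<^sup>2 * real (card (V n))"
    by (intro opnorm_less_block_one[OF T subset_refl])
  then show False using n(1) by (simp add: power2_eq_square)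
qed

end

end

theorem theorem9p1p5:
  fixes V :: "nat \<Rightarrow> 'a set" and E :: "nat \<Rightarrow> 'a \<Rightarrow> 'a \<Rightarrow> bool"
    and d :: "nat \<times> 'a \<Rightarrow> nat \<times> 'a \<Rightarrow> real" and w :: "nat \<Rightarrow> real"
  assumes "expander_seq V E"
    and "coarse_union_metric V E d"
  shows "preflow V (Cu V d) (sigma_h V w) \<and>
         (\<not> bdd_above (range (\<lambda>n. \<bar>w n\<bar>)) \<longrightarrow>
            \<not> flow V (Cu V d) (sigma_h V w) \<and>
            (\<forall>k :: nat \<times> 'a \<Rightarrow> real.
               \<not> cocycle_perturbation_of V (Cu V d) (sigma_h V w) (sigma_diag V k)))"
  by (intro conjI impI allI preflow_sigma_h[OF assms] not_flow_sigma_h[OF assms]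
      not_cocycle_perturbation_diag[OF assms])

end
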